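(* Suppose $\dot\setminus$ is included in the signature $\sigma$ and all symbols in $\sigma$ are from $\{\dot\cup,\dot\setminus,\emptyset\}$. Then the class of partial algebras $\sigma$-representable by sets is not finitely axiomatisable in first-order logic. Moreover, the class of partial algebras $\lesssim'$-completely $\sigma$-representable by sets is not closed under elementary equivalence.
   Context: Operations on sets: the disjoint union $S\mathbin{\dot\cup}T$ equals $S\cup T$ if $S\cap T=\emptyset$, and is undefined otherwise; the subset complement $S\mathbin{\dot\setminus}T$ equals $S\setminus T$ if $T\subseteq S$, and is undefined otherwise. The symbol $\emptyset$ denotes the constant empty set. A partial algebra is a (possibly empty) set together with a sequence of partial operations of finite arities. An isomorphism between similar partial algebras is a bijection $\theta$ such that for each operation $\Omega$ and corresponding operation $\Pi$, $\Omega(a_1,\dots,a_k)$ is defined if and only if $\Pi(\theta(a_1),\dots,\theta(a_k))$ is defined, and then $\theta(\Omega(a_1,\dots,a_k))=\Pi(\theta(a_1),\dots,\theta(a_k))$. A partial $\sigma$-algebra of sets is a subset of $\wp(X)$, for some base set $X$, closed under the partial operations in $\sigma$ wherever they are defined, and containing the empty set if $\emptyset$ is in $\sigma$. A $\sigma$-representation by sets of a partial algebra is an isomorphism from it to a partial $\sigma$-algebra of sets; a partial algebra is $\sigma$-representable by sets if it has one. The abstract symbols corresponding to $\dot\cup,\dot\setminus,\emptyset$ are $\dot\sqcup,\dot-,0$. In a partial algebra $\mathfrak A$ whose signature includes $\dot-$, define $a\lesssim' b$ iff $a=b$ or $b\mathbin{\dot-}a$ is defined (a partial order if $\mathfrak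 A$ is representable). A subset $S$ of $\mathfrak A$ is $\dot-$-pairwise-combinable if for all distinct $s,t\in S$ there is $u\in\mathfrak A$ such that $u\mathbin{\dot-}s$ is defined and equals $t$. A $\sigma$-representation $\theta$ is $\lesssim'$-complete if for every $\dot-$-pairwise-combinable subset $S$ of $\mathfrak A$ with a supremum $a$ with respect to $\lesssim'$ we have $a^\theta=\bigcup_{s\in S}s^\theta$. $\mathfrak A$ is $\lesssim'$-completely $\sigma$-representable if it has a $\lesssim'$-complete $\sigma$-representation. First-order notions refer to the relational view (with equality): $\dot\sqcup$ is encoded by a ternary relation symbol $J$, with $J(a,b,c)$ iff $a\mathbin{\dot\sqcup}b$ is defined and equal to $c$; $\dot-$ is encoded by a ternary relation symbol $K$, with $K(a,b,c)$ iff $a\mathbin{\dot-}b$ is defined and equal to $c$; $0$ remains a constant symbol. *)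

theory Defs
  imports Main "HOL-Library.Countable_Set"
begin

datatype symb = DUnion | DDiff | Empt

text \<open>A single record serves all signatures: a field whose symbol is not in the signature
  \<open>\<sigma>\<close> at hand is junk and is ignored by every definition below. Partial operations return
  \<open>None\<close> where they are undefined; the constant \<open>0\<close> is total. The carrier may be empty.\<close>

record 'a palg =
  carr :: "'a set"
  djoin :: "'a \<Rightarrow> 'a \<Rightarrow> 'a option"
  dminus :: "'a \<Rightarrow> 'a \<Rightarrow> 'a option"
  zero :: "'a"

definition partial_algebra :: "symb set \<Rightarrow> 'a palg \<Rightarrow> bool" where
  "partial_algebra \<sigma> A \<longleftrightarrow>
     (DUnion \<in> \<sigma> \<longrightarrow> (\<forall>a\<in>carr A. \<forall>b\<in>carr A. \<forall>c. djoin A a b = Some c \<longrightarrow> c \<in> carr A)) \<and>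
     (DDiff \<in> \<sigma> \<longrightarrow> (\<forall>a\<in>carr A. \<forall>b\<in>carr A. \<forall>c. dminus A a b = Some c \<longrightarrow> c \<in> carr A)) \<and>
     (Empt \<in> \<sigma> \<longrightarrow> zero A \<in> carr A)"

text \<open>Equality of the \<open>option\<close> values says that one side is defined iff the other is, and
  that the values then correspond.\<close>

definition palg_iso :: "symb set \<Rightarrow> ('a \<Rightarrow> 'b) \<Rightarrow> 'a palg \<Rightarrow> 'b palg \<Rightarrow> bool" where
  "palg_iso \<sigma> \<theta> A B \<longleftrightarrow>
     bij_betw \<theta> (carr A) (carr B) \<and>
     (DUnion \<in> \<sigma> \<longrightarrow> (\<forall>a\<in>carr A. \<forall>b\<in>carr A.
        map_option \<theta> (djoin A a b) = djoin B (\<theta> a) (\<theta> b))) \<and>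
     (DDiff \<in> \<sigma> \<longrightarrow> (\<forall>a\<in>carr A. \<forall>b\<in>carr A.
        map_option \<theta> (dminus A a b) = dminus B (\<theta> a) (\<theta> b))) \<and>
     (Empt \<in> \<sigma> \<longrightarrow> \<theta> (zero A) = zero B)"


section \<open>Partial algebras of sets and representations\<close>

definition disjoint_union :: "'x set \<Rightarrow> 'x set \<Rightarrow> 'x set option" where
  "disjoint_union S T = (if S \<inter> T = {} then Some (S \<union> T) else None)"

definition subset_complement :: "'x set \<Rightarrow> 'x set \<Rightarrow> 'x set option" where
  "subset_complement S T = (if T \<subseteq> S then Some (S - T) else None)"

definition set_palg :: "'x set set \<Rightarrow> 'x set palg" where
  "set_palg \<S> = \<lparr>carr = \<S>, djoin = disjoint_union, dminus = subset_complement, zero = {}\<rparr>"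

text \<open>Here \<open>partial_algebra\<close> expresses closure of \<open>\<S>\<close> under the operations of \<open>\<sigma>\<close>.\<close>

definition partial_algebra_of_sets :: "symb set \<Rightarrow> 'x set \<Rightarrow> 'x set set \<Rightarrow> bool" where
  "partial_algebra_of_sets \<sigma> X \<S> \<longleftrightarrow> \<S> \<subseteq> Pow X \<and> partial_algebra \<sigma> (set_palg \<S>)"

definition representation :: "symb set \<Rightarrow> 'a palg \<Rightarrow> 'x set \<Rightarrow> ('a \<Rightarrow> 'x set) \<Rightarrow> bool" where
  "representation \<sigma> A X \<theta> \<longleftrightarrow>
     (\<exists>\<S>. partial_algebra_of_sets \<sigma> X \<S> \<and> palg_iso \<sigma> \<theta> A (set_palg \<S>))"

definition lesssim :: "'a palg \<Rightarrow> 'a \<Rightarrow> 'a \<Rightarrow> bool" where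
  "lesssim A a b \<longleftrightarrow> a = b \<or> dminus A b a \<noteq> None"

definition pairwise_combinable :: "'a palg \<Rightarrow> 'a set \<Rightarrow> bool" where
  "pairwise_combinable A S \<longleftrightarrow>
     (\<forall>s\<in>S. \<forall>t\<in>S. s \<noteq> t \<longrightarrow> (\<exists>u\<in>carr A. dminus A u s = Some t))"

definition is_supremum :: "'a palg \<Rightarrow> 'a set \<Rightarrow> 'a \<Rightarrow> bool" where
  "is_supremum A S a \<longleftrightarrow> a \<in> carr A \<and> (\<forall>s\<in>S. lesssim A s a) \<and>
     (\<forall>b\<in>carr A. (\<forall>s\<in>S. lesssim A s b) \<longrightarrow> lesssim A a b)"

definition complete_representation ::
    "symb set \<Rightarrow> 'a palg \<Rightarrow> 'x set \<Rightarrow> ('a \<Rightarrow> 'x set) \<Rightarrow> bool" where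
  "complete_representation \<sigma> A X \<theta> \<longleftrightarrow> representation \<sigma> A X \<theta> \<and>
     (\<forall>S a. S \<subseteq> carr A \<longrightarrow> pairwise_combinable A S \<longrightarrow> is_supremum A S a \<longrightarrow>
        \<theta> a = (\<Union>s\<in>S. \<theta> s))"

text \<open>The base set ranges over the subsets of the type \<^typ>\<open>'a set\<close>, where \<open>'a\<close> is the type of
  the elements of the algebra. This is no restriction: identifying the points of a base set of
  any type that lie in the images of the same elements yields a base set of this kind; see
  \<open>representableI\<close> and \<open>completely_representableI\<close> below.\<close>

definition representable :: "symb set \<Rightarrow> 'a palg \<Rightarrow> bool" where
  "representable \<sigma> A \<longleftrightarrow> (\<exists>(X :: 'a set set) \<theta>. representation \<sigma> A X \<theta>)"

definition completely_representable :: "symb set \<Rightarrow> 'a palg \<Rightarrow> bool" where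
  "completely_representable \<sigma> A \<longleftrightarrow> (\<exists>(X :: 'a set set) \<theta>. complete_representation \<sigma> A X \<theta>)"

definition point_type :: "'a palg \<Rightarrow> ('a \<Rightarrow> 'x set) \<Rightarrow> 'x \<Rightarrow> 'a set" where
  "point_type A \<theta> x = {b \<in> carr A. x \<in> \<theta> b}"

lemma mem_point_type_image:
  "a \<in> carr A \<Longrightarrow> point_type A \<theta> x \<in> point_type A \<theta> ` \<theta> a \<longleftrightarrow> x \<in> \<theta> a"
  by (force simp: point_type_def)

lemma representation_iff:
  "representation \<sigma> A X \<theta> \<longleftrightarrow>
     partial_algebra_of_sets \<sigma> X (\<theta> ` carr A) \<and> palg_iso \<sigma> \<theta> A (set_palg (\<theta> ` carr A))"
  by (auto simp: representation_def palg_iso_def set_palg_def bij_betw_def)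

lemma representation_point_type:
  assumes "partial_algebra \<sigma> A" and "representation \<sigma> A X \<theta>"
  shows "representation \<sigma> A UNIV (\<lambda>a. point_type A \<theta> ` \<theta> a)"
proof -
  let ?p = "point_type A \<theta>"
  have iso: "palg_iso \<sigma> \<theta> A (set_palg (\<theta> ` carr A))"
    using assms(2) by (simp add: representation_iff)
  have mem: "?p x \<in> ?p ` \<theta> a \<longleftrightarrow> x \<in> \<theta> a" if "a \<in> carr A" for a x
    using that by (rule mem_point_type_image)
  have inj: "inj_on \<theta> (carr A)"
    using iso by (simp add: palg_iso_def bij_betw_def)
  have inj': "inj_on (\<lambda>a. ?p ` \<theta> a) (carr A)"
  proof (rule inj_onI)
    fix a b assume ab: "a \<in> carr A" "b \<in> carr A" "?p ` \<theta> a = ?p ` \<theta> b"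
    have "\<theta> a = \<theta> b"
      using mem[OF ab(1)] mem[OF ab(2)] ab(3) by (intro set_eqI) metis
    then show "a = b" using inj ab by (auto dest: inj_onD)
  qed
  have U: "map_option (\<lambda>a. ?p ` \<theta> a) (djoin A a b) = disjoint_union (?p ` \<theta> a) (?p ` \<theta> b)"
    if "DUnion \<in> \<sigma>" "a \<in> carr A" "b \<in> carr A" for a b
  proof -
    have "map_option \<theta> (djoin A a b) = disjoint_union (\<theta> a) (\<theta> b)"
      using iso that by (simp add: palg_iso_def set_palg_def)
    moreover have b: "b \<in> carr A" by (rule that)
    moreover have "?p ` \<theta> a \<inter> ?p ` \<theta> b = {} \<longleftrightarrow> \<theta> a \<inter> \<theta> b = {}"
    proof -
      have "y \<notin> ?p ` \<theta> b" if dj: "\<theta> a \<inter> \<theta> b = {}" and y: "y \<in> ?p ` \<theta> a" for y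
      proof -
        obtain x where "y = ?p x" "x \<in> \<theta> a" using y by (rule imageE)
        then show ?thesis using mem[OF b, of x] dj by auto
      qed
      then show ?thesis by (auto simp only: disjoint_iff intro: imageI)
    qed
    ultimately show ?thesis
      by (cases "djoin A a b") (auto simp: disjoint_union_def image_Un split: if_splits)
  qed
  have D: "map_option (\<lambda>a. ?p ` \<theta> a) (dminus A a b) = subset_complement (?p ` \<theta> a) (?p ` \<theta> b)"
    if "DDiff \<in> \<sigma>" "a \<in> carr A" "b \<in> carr A" for a b
  proof -
    have "map_option \<theta> (dminus A a b) = subset_complement (\<theta> a) (\<theta> b)"
      using iso that by (simp add: palg_iso_def set_palg_def)
    moreover have "?p ` \<theta> b \<subseteq> ?p ` \<theta> a \<longleftrightarrow> \<theta> b \<subseteq> \<theta> a"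
    proof
      assume sub: "?p ` \<theta> b \<subseteq> ?p ` \<theta> a"
      show "\<theta> b \<subseteq> \<theta> a"
      proof
        fix x assume "x \<in> \<theta> b"
        then have "?p x \<in> ?p ` \<theta> a" using sub by (blast intro: imageI)
        then show "x \<in> \<theta> a" using mem[OF that(2), of x] by (rule iffD1[rotated])
      qed
    qed (rule image_mono)
    moreover have "?p ` (\<theta> a - \<theta> b) = ?p ` \<theta> a - ?p ` \<theta> b"
    proof (intro equalityI subsetI)
      fix y assume "y \<in> ?p ` (\<theta> a - \<theta> b)"
      then obtain x where "y = ?p x" "x \<in> \<theta> a - \<theta> b" by (rule imageE)
      then show "y \<in> ?p ` \<theta> a - ?p ` \<theta> b"
        using mem[OF that(3), of x] by simp
    next
      fix y assume y: "y \<in> ?p ` \<theta> a - ?p ` \<theta> b"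
      then obtain x where "y = ?p x" "x \<in> \<theta> a" by (blast elim: imageE)
      then show "y \<in> ?p ` (\<theta> a - \<theta> b)" using y by (auto intro!: imageI)
    qed
    ultimately show ?thesis
      by (cases "dminus A a b") (auto simp: subset_complement_def split: if_splits)
  qed
  have Z: "?p ` \<theta> (zero A) = {}" if "Empt \<in> \<sigma>"
    using iso that by (simp add: palg_iso_def set_palg_def)
  have iso': "palg_iso \<sigma> (\<lambda>a. ?p ` \<theta> a) A (set_palg ((\<lambda>a. ?p ` \<theta> a) ` carr A))"
    using inj' U D Z by (simp add: palg_iso_def set_palg_def bij_betw_def)
  have "partial_algebra \<sigma> (set_palg ((\<lambda>a. ?p ` \<theta> a) ` carr A))"
  proof -
    have "c \<in> (\<lambda>a. ?p ` \<theta> a) ` carr A"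
      if "DUnion \<in> \<sigma>" "a \<in> carr A" "b \<in> carr A"
        and c: "disjoint_union (?p ` \<theta> a) (?p ` \<theta> b) = Some c" for a b c
    proof -
      have "map_option (\<lambda>a. ?p ` \<theta> a) (djoin A a b) = Some c"
        using U[OF that(1-3)] c by (rule trans)
      then obtain d where d: "djoin A a b = Some d" "?p ` \<theta> d = c"
        unfolding map_option_eq_Some by (elim exE conjE)
      then have "d \<in> carr A" using assms(1) that(1-3) unfolding partial_algebra_def by blast
      then show ?thesis unfolding d(2)[symmetric] by (rule imageI)
    qed
    moreover have "c \<in> (\<lambda>a. ?p ` \<theta> a) ` carr A"
      if "DDiff \<in> \<sigma>" "a \<in> carr A" "b \<in> carr A"
        and c: "subset_complement (?p ` \<theta> a) (?p ` \<theta> b) = Some c" for a b c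
    proof -
      have "map_option (\<lambda>a. ?p ` \<theta> a) (dminus A a b) = Some c"
        using D[OF that(1-3)] c by (rule trans)
      then obtain d where d: "dminus A a b = Some d" "?p ` \<theta> d = c"
        unfolding map_option_eq_Some by (elim exE conjE)
      then have "d \<in> carr A" using assms(1) that(1-3) unfolding partial_algebra_def by blast
      then show ?thesis unfolding d(2)[symmetric] by (rule imageI)
    qed
    moreover have "{} \<in> (\<lambda>a. ?p ` \<theta> a) ` carr A" if "Empt \<in> \<sigma>"
    proof (rule image_eqI)
      show "{} = ?p ` \<theta> (zero A)" using Z[OF that] by (rule sym)
      show "zero A \<in> carr A" using assms(1) that by (simp add: partial_algebra_def)
    qed
    ultimately show ?thesis
      unfolding partial_algebra_def set_palg_def palg.simps ball_simps by blast
  qed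
  then show ?thesis
    using iso' by (simp add: representation_iff partial_algebra_of_sets_def)
qed

lemma representableI:
  assumes "partial_algebra \<sigma> A" and "representation \<sigma> A (X :: 'x set) \<theta>"
  shows "representable \<sigma> A"
  unfolding representable_def by (intro exI) (rule representation_point_type[OF assms])

lemma completely_representableI:
  assumes "partial_algebra \<sigma> A" and "complete_representation \<sigma> A (X :: 'x set) \<theta>"
  shows "completely_representable \<sigma> A"
proof -
  have "representation \<sigma> A X \<theta>"
    using assms(2) by (simp only: complete_representation_def)
  then have rep: "representation \<sigma> A UNIV (\<lambda>a. point_type A \<theta> ` \<theta> a)"
    by (rule representation_point_type[OF assms(1)])
  have sup: "point_type A \<theta> ` \<theta> a = (\<Union>s\<in>S. point_type A \<theta> ` \<theta> s)"
    if "S \<subseteq> carr A" "pairwise_combinable A S" "is_supremum A S a" for S a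
  proof -
    have "\<theta> a = (\<Union>s\<in>S. \<theta> s)"
      using assms(2) that by (simp only: complete_representation_def)
    then show ?thesis by (simp only: image_UN)
  qed
  have "complete_representation \<sigma> A UNIV (\<lambda>a. point_type A \<theta> ` \<theta> a)"
    unfolding complete_representation_def by (intro conjI allI impI rep sup)
  then show ?thesis
    unfolding completely_representable_def by (intro exI)
qed


section \<open>First-order logic over the relational view\<close>

datatype tm = Var nat | Zero

datatype fm =
    Eq tm tm
  | RelJ tm tm tm
  | RelK tm tm tm
  | Neg fm
  | Conj fm fm
  | Exi nat fm

fun tm_vars :: "tm \<Rightarrow> nat set" where
  "tm_vars (Var n) = {n}"
| "tm_vars Zero = {}"

fun tm_symbs :: "tm \<Rightarrow> symb set" where
  "tm_symbs (Var n) = {}"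
| "tm_symbs Zero = {Empt}"

fun free_vars :: "fm \<Rightarrow> nat set" where
  "free_vars (Eq r s) = tm_vars r \<union> tm_vars s"
| "free_vars (RelJ r s t) = tm_vars r \<union> tm_vars s \<union> tm_vars t"
| "free_vars (RelK r s t) = tm_vars r \<union> tm_vars s \<union> tm_vars t"
| "free_vars (Neg \<phi>) = free_vars \<phi>"
| "free_vars (Conj \<phi> \<psi>) = free_vars \<phi> \<union> free_vars \<psi>"
| "free_vars (Exi n \<phi>) = free_vars \<phi> - {n}"

fun symbs :: "fm \<Rightarrow> symb set" where
  "symbs (Eq r s) = tm_symbs r \<union> tm_symbs s"
| "symbs (RelJ r s t) = {DUnion} \<union> tm_symbs r \<union> tm_symbs s \<union> tm_symbs t"
| "symbs (RelK r s t) = {DDiff} \<union> tm_symbs r \<union> tm_symbs s \<union> tm_symbs t"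
| "symbs (Neg \<phi>) = symbs \<phi>"
| "symbs (Conj \<phi> \<psi>) = symbs \<phi> \<union> symbs \<psi>"
| "symbs (Exi n \<phi>) = symbs \<phi>"

definition sentence :: "symb set \<Rightarrow> fm \<Rightarrow> bool" where
  "sentence \<sigma> \<phi> \<longleftrightarrow> free_vars \<phi> = {} \<and> symbs \<phi> \<subseteq> \<sigma>"

fun val :: "'a palg \<Rightarrow> (nat \<Rightarrow> 'a) \<Rightarrow> tm \<Rightarrow> 'a" where
  "val A e (Var n) = e n"
| "val A e Zero = zero A"

fun sat :: "'a palg \<Rightarrow> (nat \<Rightarrow> 'a) \<Rightarrow> fm \<Rightarrow> bool" where
  "sat A e (Eq r s) \<longleftrightarrow> val A e r = val A e s"
| "sat A e (RelJ r s t) \<longleftrightarrow> djoin A (val A e r) (val A e s) = Some (val A e t)"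
| "sat A e (RelK r s t) \<longleftrightarrow> dminus A (val A e r) (val A e s) = Some (val A e t)"
| "sat A e (Neg \<phi>) \<longleftrightarrow> \<not> sat A e \<phi>"
| "sat A e (Conj \<phi> \<psi>) \<longleftrightarrow> sat A e \<phi> \<and> sat A e \<psi>"
| "sat A e (Exi n \<phi>) \<longleftrightarrow> (\<exists>a\<in>carr A. sat A (e(n := a)) \<phi>)"

text \<open>Assignments may take values outside the carrier, so that they exist even if the carrier
  is empty. For sentences the choice of the assignment is immaterial (\<open>models_iff\<close>).\<close>

definition models :: "'a palg \<Rightarrow> fm \<Rightarrow> bool" where
  "models A \<phi> \<longleftrightarrow> (\<forall>e. sat A e \<phi>)"

lemma val_cong: "(\<And>n. n \<in> tm_vars t \<Longrightarrow> e n = e' n) \<Longrightarrow> val A e t = val A e' t"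
  by (cases t) auto

lemma sat_cong: "(\<And>n. n \<in> free_vars \<phi> \<Longrightarrow> e n = e' n) \<Longrightarrow> sat A e \<phi> = sat A e' \<phi>"
proof (induction \<phi> arbitrary: e e')
  case (Eq r s)
  then have "val A e r = val A e' r" "val A e s = val A e' s" by (auto intro!: val_cong)
  then show ?case by simp
next
  case (RelJ r s t)
  then have "val A e r = val A e' r" "val A e s = val A e' s" "val A e t = val A e' t"
    by (auto intro!: val_cong)
  then show ?case by simp
next
  case (RelK r s t)
  then have "val A e r = val A e' r" "val A e s = val A e' s" "val A e t = val A e' t"
    by (auto intro!: val_cong)
  then show ?case by simp
next
  case (Neg \<phi>)
  have "sat A e \<phi> = sat A e' \<phi>" by (rule Neg.IH) (simp add: Neg.prems)
  then show ?case by simp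
next
  case (Conj \<phi> \<psi>)
  have "sat A e \<phi> = sat A e' \<phi>" by (rule Conj.IH(1)) (simp add: Conj.prems)
  moreover have "sat A e \<psi> = sat A e' \<psi>" by (rule Conj.IH(2)) (simp add: Conj.prems)
  ultimately show ?case by simp
next
  case (Exi n \<phi>)
  have "sat A (e(n := a)) \<phi> = sat A (e'(n := a)) \<phi>" for a
    by (rule Exi.IH) (simp add: Exi.prems)
  then show ?case by simp
qed

lemma models_iff: "sentence \<sigma> \<phi> \<Longrightarrow> models A \<phi> \<longleftrightarrow> sat A e \<phi>"
  unfolding models_def sentence_def by (metis empty_iff sat_cong)

definition elementarily_equivalent :: "symb set \<Rightarrow> 'a palg \<Rightarrow> 'b palg \<Rightarrow> bool" where
  "elementarily_equivalent \<sigma> A B \<longleftrightarrow> (\<forall>\<phi>. sentence \<sigma> \<phi> \<longrightarrow> (models A \<phi> \<longleftrightarrow> models B \<phi>))"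

text \<open>A class of partial algebras is given by a predicate on the partial algebras whose elements
  come from a universe type \<open>'u\<close>.\<close>

definition finitely_axiomatisable :: "symb set \<Rightarrow> ('u palg \<Rightarrow> bool) \<Rightarrow> bool" where
  "finitely_axiomatisable \<sigma> \<K> \<longleftrightarrow>
     (\<exists>T. finite T \<and> (\<forall>\<phi>\<in>T. sentence \<sigma> \<phi>) \<and>
        (\<forall>A. partial_algebra \<sigma> A \<longrightarrow> (\<K> A \<longleftrightarrow> (\<forall>\<phi>\<in>T. models A \<phi>))))"

definition closed_under_elementary_equivalence :: "symb set \<Rightarrow> ('u palg \<Rightarrow> bool) \<Rightarrow> bool" where
  "closed_under_elementary_equivalence \<sigma> \<K> \<longleftrightarrow>
     (\<forall>A B. partial_algebra \<sigma> A \<longrightarrow> partial_algebra \<sigma> B \<longrightarrow>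
        elementarily_equivalent \<sigma> A B \<longrightarrow> \<K> A \<longrightarrow> \<K> B)"

end

(* A perfect matching of the complete bipartite graph between m and n is a set of cells of the grid
   m x n with exactly one cell in every row and every column. Call two cells orthogonal if no matching
   contains both, that is, if they lie in a common row or column and differ. The orthocomplements of
   finite or cofinite parts of rows and columns form a partial algebra in which each row and each column
   is a partition of 1. If m = n it is completely represented by sets of matchings.
   Conversely, a point of a representation which, for every row and column, lies in the image of one of
   its cells is itself a matching. Such points exist if the representation is complete or if m and n are
   finite, and then |m| = |n|. An Ehrenfeucht-Fraisse game on cells of
   equal capped size shows that sentences of bounded quantifier depth do not distinguish m, n of
   different large size. Hence k x k versus k x (k+1) refutes finite axiomatisability, and
   nat x nat versus nat x 'v with 'v uncountable refutes closure under elementary equivalence. *)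

theory Submission
  imports Defs "HOL-Library.Nat_Bijection" "HOL-Combinatorics.Transposition"
begin

section \<open>Orthogonality spaces and their partial algebras\<close>

text \<open>A point of a representation acts like a two-valued state: it lies in exactly one of the
  images whenever pairwise disjoint images exhaust \<open>\<theta> P\<close>. The difficulty is to
  hide the obstruction to such states from every single sentence. Orthogonality of rectangles
  depends on the two coordinates separately, so the game splits into two games on bare sets, and
  bare sets differ only in their truncated sizes. Finite and cofinite parts are chosen for reasons
  of cardinality: the family of all parts of an infinite line can outgrow the universe type, whereas
  finite lists of cells embed in it. Within an arbitrary representation only subset complement is
  exploited, the one operation present in every signature considered; disjointness, finite unions
  and the empty set are recovered from it. The algebra is developed for abstract orthogonality
  spaces. There \<open>compatible_on_line\<close> is the Dacey condition: it makes the complement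
  inside a line agree with the orthocomplement.\<close>

text \<open>The elements of \<open>lines\<close> are the maximal cliques of orthogonality. In the theorem the points are
  the cells of a grid; the elements of \<open>alg\<close> are identified with the sets of atoms below them.\<close>

locale orth_space =
  fixes P :: "'p set" and orth :: "'p \<Rightarrow> 'p \<Rightarrow> bool" and lines :: "'p set set"
  assumes orth_sym: "orth p q \<Longrightarrow> orth q p"
    and orth_irrefl: "\<not> orth p p"
    and line_subset: "L \<in> lines \<Longrightarrow> L \<subseteq> P"
    and line_orth: "L \<in> lines \<Longrightarrow> p \<in> L \<Longrightarrow> q \<in> L \<Longrightarrow> p \<noteq> q \<Longrightarrow> orth p q"
    and clique_in_line: "C \<subseteq> P \<Longrightarrow> (\<And>p q. p \<in> C \<Longrightarrow> q \<in> C \<Longrightarrow> p \<noteq> q \<Longrightarrow> orth p q) \<Longrightarrow>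
      \<exists>L\<in>lines. C \<subseteq> L"
    and compatible_on_line: "p \<in> P \<Longrightarrow> q \<in> P \<Longrightarrow> \<not> orth p q \<Longrightarrow> L \<in> lines \<Longrightarrow>
      \<exists>r\<in>L. \<not> orth r p \<and> \<not> orth r q"
    and infinite_Int_lines: "L \<in> lines \<Longrightarrow> L' \<in> lines \<Longrightarrow> infinite (L \<inter> L') \<Longrightarrow> L = L'"
begin

definition perp :: "'p set \<Rightarrow> 'p set" where
  "perp x = {q \<in> P. \<forall>p\<in>x. orth p q}"

text \<open>Finite or cofinite relative to a line: this family is closed under complement in the
  line, and each member is described by finitely many points, which \<open>carr_inj\<close> uses to
  bound the carrier.\<close>

definition adm :: "'p set \<Rightarrow> bool" where
  "adm x \<longleftrightarrow> (\<exists>L\<in>lines. x \<subseteq> L \<and> (finite x \<or> finite (L - x)))"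

text \<open>The elements are closed under double \<open>perp\<close>. For them
  \<open>perp (perp a \<inter> perp b)\<close> is the closure of \<open>a \<union> b\<close>, and
  \<open>a \<inter> perp b\<close> is the relative orthocomplement, as in a quantum logic.\<close>

definition alg :: "'p set palg" where
  "alg = \<lparr>carr = {perp (perp x) |x. adm x},
     djoin = (\<lambda>a b. if a \<subseteq> perp b then Some (perp (perp a \<inter> perp b)) else None),
     dminus = (\<lambda>a b. if b \<subseteq> a then Some (a \<inter> perp b) else None),
     zero = {}\<rparr>"

definition matching :: "'p set \<Rightarrow> bool" where
  "matching f \<longleftrightarrow> f \<subseteq> P \<and> (\<forall>p\<in>f. \<forall>q\<in>f. \<not> orth p q) \<and> (\<forall>L\<in>lines. f \<inter> L \<noteq> {})"

section \<open>Calculus of orthocomplements\<close>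

lemma alg_simps [simp]:
  "carr alg = {perp (perp x) |x. adm x}"
  "djoin alg a b = (if a \<subseteq> perp b then Some (perp (perp a \<inter> perp b)) else None)"
  "dminus alg a b = (if b \<subseteq> a then Some (a \<inter> perp b) else None)"
  "zero alg = {}"
  by (simp_all add: alg_def)

lemma lesssim_alg: "lesssim alg a b \<longleftrightarrow> a \<subseteq> b"
  by (auto simp: lesssim_def)

lemma perp_subset: "perp x \<subseteq> P"
  by (auto simp: perp_def)

lemma perp_antimono: "x \<subseteq> y \<Longrightarrow> perp y \<subseteq> perp x"
  by (auto simp: perp_def)

lemma perp_Un: "perp (x \<union> y) = perp x \<inter> perp y"
  by (auto simp: perp_def)

lemma perp_empty [simp]: "perp {} = P"
  by (auto simp: perp_def)

lemma perp_P [simp]: "perp P = {}"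
  using orth_irrefl by (auto simp: perp_def)

lemma subset_perp_perp: "x \<subseteq> P \<Longrightarrow> x \<subseteq> perp (perp x)"
  using orth_sym by (auto simp: perp_def)

lemma perp_perp_perp: "x \<subseteq> P \<Longrightarrow> perp (perp (perp x)) = perp x"
  by (intro equalityI perp_antimono subset_perp_perp perp_subset)

lemma subset_perp_commute: "x \<subseteq> P \<Longrightarrow> y \<subseteq> P \<Longrightarrow> x \<subseteq> perp y \<longleftrightarrow> y \<subseteq> perp x"
  using orth_sym unfolding perp_def by blast

text \<open>If \<open>p \<in> perp x\<close> and \<open>q \<in> perp (L - x)\<close> were not
  orthogonal, some \<open>r \<in> L\<close> would be orthogonal to neither. But such an
  \<open>r\<close> can lie neither in \<open>x\<close> nor in \<open>L - x\<close>. Complements may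
  therefore be computed inside any line through \<open>x\<close>.\<close>

lemma perp_Diff:
  assumes L: "L \<in> lines" and x: "x \<subseteq> L"
  shows "perp (L - x) = perp (perp x)"
proof
  have "L - x \<subseteq> perp x"
    using line_orth[OF L] line_subset[OF L] x by (auto simp: perp_def)
  then show "perp (perp x) \<subseteq> perp (L - x)" by (rule perp_antimono)
  show "perp (L - x) \<subseteq> perp (perp x)"
  proof
    fix q assume q: "q \<in> perp (L - x)"
    then have qP: "q \<in> P" by (simp add: perp_def)
    have "orth p q" if p: "p \<in> perp x" for p
    proof (rule ccontr)
      assume "\<not> orth p q"
      then obtain r where "r \<in> L" "\<not> orth r p" "\<not> orth r q"
        using compatible_on_line[of p q L] p qP L by (auto simp: perp_def)
      then show False using p q by (auto simp: perp_def)
    qed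
    then show "q \<in> perp (perp x)" using qP by (simp add: perp_def)
  qed
qed

section \<open>Admissible sets and closure under the operations\<close>

lemma adm_subset: "adm x \<Longrightarrow> x \<subseteq> P"
  using line_subset by (auto simp: adm_def)

lemma adm_perp_perp_perp [simp]: "adm x \<Longrightarrow> perp (perp (perp x)) = perp x"
  using adm_subset perp_perp_perp by blast

lemma adm_finite: "L \<in> lines \<Longrightarrow> x \<subseteq> L \<Longrightarrow> finite x \<Longrightarrow> adm x"
  by (auto simp: adm_def)

text \<open>An infinite set lies on at most one line, so the line witnessing \<open>adm\<close> may
  be exchanged for any other line through \<open>x\<close>.\<close>

lemma adm_lineE:
  assumes "adm x" and "x \<subseteq> L" "L \<in> lines"
  shows "finite x \<or> finite (L - x)"
proof (rule disjCI)
  assume "infinite (L - x)"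
  show "finite x"
  proof (rule ccontr)
    assume inf: "infinite x"
    obtain L' where L': "L' \<in> lines" "x \<subseteq> L'" "finite (L' - x)"
      using assms(1) inf by (auto simp: adm_def)
    have "infinite (L \<inter> L')" using inf L'(2) assms(2) by (meson Int_greatest infinite_super)
    then have "L = L'" using infinite_Int_lines assms(3) L'(1) by blast
    then show False using L'(3) \<open>infinite (L - x)\<close> by simp
  qed
qed

lemma adm_Diff: "adm x \<Longrightarrow> x \<subseteq> L \<Longrightarrow> L \<in> lines \<Longrightarrow> adm (L - x)"
  using adm_lineE[of x L] unfolding adm_def by (intro bexI[of _ L]) (auto simp: double_diff)

text \<open>Two orthogonal parts of lines together form a clique, hence fit on one line. This
  reduces every defined operation to Boolean operations on subsets of a single line.\<close>

lemma adm_orthogonal_Un: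
  assumes x: "adm x" and y: "adm y" and xy: "x \<subseteq> perp y"
  obtains L where "L \<in> lines" "x \<subseteq> L" "y \<subseteq> L" "adm (x \<union> y)"
proof -
  obtain Lx Ly where "Lx \<in> lines" "x \<subseteq> Lx" "Ly \<in> lines" "y \<subseteq> Ly"
    using x y unfolding adm_def by blast
  then have "orth p q" if "p \<in> x \<union> y" "q \<in> x \<union> y" "p \<noteq> q" for p q
    using that xy line_orth orth_sym unfolding perp_def by blast
  then obtain L where L: "L \<in> lines" "x \<union> y \<subseteq> L"
    using clique_in_line[of "x \<union> y"] adm_subset[OF x] adm_subset[OF y] by auto
  have "finite (x \<union> y) \<or> finite (L - (x \<union> y))"
    using adm_lineE[OF x, of L] adm_lineE[OF y, of L] L
    by (auto intro: finite_subset[of "L - (x \<union> y)" "L - x"] finite_subset[of "L - (x \<union> y)" "L - y"])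
  then have "adm (x \<union> y)" using L unfolding adm_def by blast
  then show thesis using that[of L] L by blast
qed

lemma carrE:
  assumes "a \<in> carr alg" obtains x where "adm x" "a = perp (perp x)"
  using assms by auto

lemma perp_mem_carr:
  assumes "adm x" shows "perp x \<in> carr alg"
proof -
  obtain L where L: "L \<in> lines" "x \<subseteq> L" using assms by (auto simp: adm_def)
  have "perp (perp (L - x)) = perp x" by (simp add: perp_Diff[OF L] assms)
  then show ?thesis using adm_Diff[OF assms L(2,1)] by auto
qed

text \<open>The dual normal form, obtained by complementing in a line. With the minuend written as
  \<open>perp y\<close>, a difference becomes \<open>perp\<close> of a union.\<close>

lemma carr_perpE:
  assumes "a \<in> carr alg" obtains x where "adm x" "a = perp x"
proof -
  obtain x where x: "adm x" "a = perp (perp x)" using carrE assms by blast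
  obtain L where L: "L \<in> lines" "x \<subseteq> L" using x by (auto simp: adm_def)
  show thesis using that[OF adm_Diff[OF x(1) L(2,1)]] x(2) perp_Diff[OF L] by simp
qed

lemma partial_algebra_alg:
  assumes "lines \<noteq> {}"
  shows "partial_algebra \<sigma> alg"
proof -
  have "perp (perp a \<inter> perp b) \<in> carr alg"
    if ab: "a \<in> carr alg" "b \<in> carr alg" "a \<subseteq> perp b" for a b
  proof -
    obtain x where x: "adm x" "a = perp (perp x)" using carrE ab(1) by blast
    obtain y where y: "adm y" "b = perp (perp y)" using carrE ab(2) by blast
    have "x \<subseteq> perp y"
      using ab(3) subset_perp_perp[OF adm_subset[OF x(1)]] y(1) unfolding x(2) y(2) by auto
    then have "adm (x \<union> y)" using adm_orthogonal_Un[OF x(1) y(1)] by metis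
    moreover have "perp (perp a \<inter> perp b) = perp (perp (x \<union> y))"
      using x y by (simp add: perp_Un)
    ultimately show ?thesis unfolding alg_simps by blast
  qed
  moreover have "a \<inter> perp b \<in> carr alg"
    if ab: "a \<in> carr alg" "b \<in> carr alg" "b \<subseteq> a" for a b
  proof -
    obtain x where x: "adm x" "b = perp (perp x)" using carrE ab(2) by blast
    obtain y where y: "adm y" "a = perp y" using carr_perpE ab(1) by blast
    have "x \<subseteq> perp y"
      using ab(3) subset_perp_perp[OF adm_subset[OF x(1)]] y(1) unfolding x(2) y(2) by auto
    then have "adm (y \<union> x)"
      using adm_orthogonal_Un[OF x(1) y(1)] by (metis Un_commute)
    then show ?thesis
      using perp_mem_carr[of "y \<union> x"] x by (simp add: y(2) perp_Un del: alg_simps)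
  qed
  moreover have "{} \<in> carr alg"
  proof -
    have "adm {}" using assms by (auto simp: adm_def)
    then have "perp (perp {}) \<in> carr alg" by (simp only: alg_simps) blast
    then show ?thesis by simp
  qed
  ultimately show ?thesis
    unfolding partial_algebra_def by (metis alg_simps(2,3,4) option.distinct(1) option.inject)
qed

section \<open>Matchings and the elements they meet\<close>

lemma matching_orth: "matching f \<Longrightarrow> p \<in> f \<Longrightarrow> q \<in> f \<Longrightarrow> \<not> orth p q"
  by (auto simp: matching_def)

lemma matching_lineE:
  assumes "matching f" "L \<in> lines"
  obtains p where "p \<in> f" "p \<in> L"
  using assms unfolding matching_def by blast

lemma matching_line_unique:
  "matching f \<Longrightarrow> L \<in> lines \<Longrightarrow> p \<in> f \<Longrightarrow> q \<in> f \<Longrightarrow> p \<in> L \<Longrightarrow> q \<in> L \<Longrightarrow> p = q"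
  using matching_orth line_orth by metis

lemma perp_orth: "q \<in> perp x \<Longrightarrow> p \<in> x \<Longrightarrow> orth p q"
  by (simp add: perp_def)

definition matchings :: "'p set \<Rightarrow> 'p set set" where
  "matchings a = {f. matching f \<and> f \<inter> a \<noteq> {}}"

text \<open>A matching has a point \<open>r\<close> on \<open>L\<close>. If \<open>r\<close> were
  outside \<open>x\<close>, it would be in \<open>perp x\<close> and thus orthogonal to every point
  of the closure, so the matching could not meet the closure.\<close>

lemma matchings_perp_perp:
  assumes L: "L \<in> lines" and x: "x \<subseteq> L"
  shows "matchings (perp (perp x)) = matchings x"
proof (intro equalityI subsetI)
  fix f assume "f \<in> matchings (perp (perp x))"
  then obtain q where f: "matching f" and q: "q \<in> f" "q \<in> perp (perp x)"
    by (auto simp: matchings_def)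
  obtain r where r: "r \<in> f" "r \<in> L" using matching_lineE[OF f L] .
  have "r \<in> x"
  proof (rule ccontr)
    assume "r \<notin> x"
    then have "r \<in> perp x"
      using r(2) x line_orth[OF L] line_subset[OF L] by (auto simp: perp_def)
    then show False using perp_orth[OF q(2)] matching_orth[OF f r(1) q(1)] by blast
  qed
  then show "f \<in> matchings x" using f r(1) by (auto simp: matchings_def)
next
  fix f assume "f \<in> matchings x"
  then show "f \<in> matchings (perp (perp x))"
    using subset_perp_perp[of x] x line_subset[OF L] by (auto simp: matchings_def)
qed

lemma matchings_perp: "L \<in> lines \<Longrightarrow> x \<subseteq> L \<Longrightarrow> matchings (perp x) = matchings (L - x)"
  using matchings_perp_perp[of L "L - x"] line_subset[of L]
  by (simp add: perp_Diff perp_perp_perp subset_trans[of x L P])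

lemma matchings_Un: "matchings (x \<union> y) = matchings x \<union> matchings y"
  by (auto simp: matchings_def)

text \<open>A common line is essential: a matching has just one point there, so it cannot meet
  \<open>x - y\<close> in one point and \<open>y\<close> in another.\<close>

lemma matchings_Diff:
  assumes "L \<in> lines" "x \<subseteq> L" "y \<subseteq> L"
  shows "matchings (x - y) = matchings x - matchings y"
proof
  show "matchings (x - y) \<subseteq> matchings x - matchings y"
  proof
    fix f assume "f \<in> matchings (x - y)"
    then obtain p where f: "matching f" and p: "p \<in> f" "p \<in> x" "p \<notin> y"
      by (auto simp: matchings_def)
    have "q \<notin> y" if "q \<in> f" for q
      using matching_line_unique[OF f assms(1) p(1) that] p assms(2,3) by auto
    then show "f \<in> matchings x - matchings y" using f p by (auto simp: matchings_def)
  qed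
qed (auto simp: matchings_def)

end

section \<open>Complete representation by matchings\<close>

locale matched_orth_space = orth_space +
  assumes lines_nonempty: "lines \<noteq> {}"
    and matching_through: "p \<in> P \<Longrightarrow> q \<in> P \<Longrightarrow> \<not> orth p q \<Longrightarrow> \<exists>f. matching f \<and> p \<in> f \<and> q \<in> f"
begin

text \<open>By \<open>matching_through\<close> a non-orthogonal pair yields a matching that meets
  both sets. The pair may consist of one point twice, so every point lies on a matching.\<close>

lemma matchings_disjoint_iff:
  assumes "x \<subseteq> P" "y \<subseteq> P"
  shows "matchings x \<inter> matchings y = {} \<longleftrightarrow> x \<subseteq> perp y"
proof
  assume dj: "matchings x \<inter> matchings y = {}"
  have "orth q p" if pq: "p \<in> x" "q \<in> y" for p q
  proof (rule ccontr)
    assume "\<not> orth q p"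
    then obtain f where "matching f" "p \<in> f" "q \<in> f"
      using matching_through[of q p] pq assms by blast
    then show False using dj pq by (auto simp: matchings_def)
  qed
  then show "x \<subseteq> perp y" using assms by (auto simp: perp_def)
next
  assume sub: "x \<subseteq> perp y"
  have False if f: "matching f" "p \<in> f" "p \<in> x" "q \<in> f" "q \<in> y" for f p q
    using sub perp_orth[of p y q] matching_orth[OF f(1,4,2)] f by blast
  then show "matchings x \<inter> matchings y = {}"
    by (auto simp: matchings_def)
qed

text \<open>Writing \<open>a\<close> as \<open>perp y\<close> turns inclusion in \<open>a\<close>
  into disjointness from \<open>y\<close>, which matchings detect.\<close>

lemma matchings_subset_iff:
  assumes "a \<in> carr alg" "b \<in> carr alg"
  shows "matchings b \<subseteq> matchings a \<longleftrightarrow> b \<subseteq> a"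
proof
  assume sub: "matchings b \<subseteq> matchings a"
  obtain y where y: "adm y" "a = perp y" using carr_perpE assms(1) by blast
  have "matchings b \<inter> matchings y = {}"
    using sub matchings_disjoint_iff[of a y] y adm_subset perp_subset by auto
  then show "b \<subseteq> a"
    using matchings_disjoint_iff[of b y] y adm_subset assms perp_subset by auto
qed (auto simp: matchings_def)

lemma representation_matchings: "representation \<sigma> alg UNIV matchings"
proof -
  have inj: "inj_on matchings (carr alg)"
  proof (rule inj_onI)
    fix a b assume "a \<in> carr alg" "b \<in> carr alg" "matchings a = matchings b"
    then show "a = b"
      using matchings_subset_iff[of a b] matchings_subset_iff[of b a] by (intro equalityI) blast+
  qed
  have J: "map_option matchings (djoin alg a b) = disjoint_union (matchings a) (matchings b)"
    if ab: "a \<in> carr alg" "b \<in> carr alg" for a b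
  proof -
    obtain x where x: "adm x" "a = perp (perp x)" using carrE ab(1) by blast
    obtain y where y: "adm y" "b = perp (perp y)" using carrE ab(2) by blast
    have dj: "matchings a \<inter> matchings b = {} \<longleftrightarrow> a \<subseteq> perp b"
      by (rule matchings_disjoint_iff) (use x y perp_subset in auto)
    moreover have "matchings (perp (perp a \<inter> perp b)) = matchings a \<union> matchings b"
      if "a \<subseteq> perp b"
    proof -
      have xy: "x \<subseteq> perp y"
        using that subset_perp_perp[OF adm_subset[OF x(1)]] y(1) unfolding x(2) y(2) by auto
      then obtain L where L: "L \<in> lines" "x \<subseteq> L" "y \<subseteq> L"
        using adm_orthogonal_Un[OF x(1) y(1)] by blast
      have "perp (perp a \<inter> perp b) = perp (perp (x \<union> y))"
        using x y by (simp add: perp_Un)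
      then show ?thesis using L by (simp add: matchings_perp_perp matchings_Un x(2) y(2))
    qed
    ultimately show ?thesis by (simp add: disjoint_union_def)
  qed
  have K: "map_option matchings (dminus alg a b) = subset_complement (matchings a) (matchings b)"
    if ab: "a \<in> carr alg" "b \<in> carr alg" for a b
  proof -
    have "matchings (a \<inter> perp b) = matchings a - matchings b" if "b \<subseteq> a"
    proof -
      obtain x where x: "adm x" "b = perp (perp x)" using carrE ab(2) by blast
      obtain y where y: "adm y" "a = perp y" using carr_perpE ab(1) by blast
      have xy: "x \<subseteq> perp y"
        using that subset_perp_perp[OF adm_subset[OF x(1)]] y(1) unfolding x(2) y(2) by auto
      then obtain L where L: "L \<in> lines" "x \<subseteq> L" "y \<subseteq> L"
        using adm_orthogonal_Un[OF x(1) y(1)] by blast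
      \<comment> \<open>On the common line, \<open>a\<close> has the same matchings as
        \<open>L - y\<close>, and \<open>b\<close> the same as \<open>x\<close>.\<close>
      have "matchings (a \<inter> perp b) = matchings (L - (y \<union> x))"
        using matchings_perp[of L "y \<union> x"] L x by (simp add: y(2) perp_Un)
      also have "L - (y \<union> x) = (L - y) - x" by blast
      also have "matchings \<dots> = matchings (L - y) - matchings x"
        using L by (intro matchings_Diff) auto
      finally show ?thesis using L by (simp add: x(2) y(2) matchings_perp matchings_perp_perp)
    qed
    then show ?thesis
      using matchings_subset_iff[OF ab] by (simp add: subset_complement_def)
  qed
  have Z: "matchings (zero alg) = {}" by (simp add: matchings_def)
  have pa: "partial_algebra \<sigma> alg" using lines_nonempty by (rule partial_algebra_alg)
  have "partial_algebra \<sigma> (set_palg (matchings ` carr alg))"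
    unfolding partial_algebra_def
  proof (intro conjI impI ballI allI)
    fix a' b' c' assume s: "DUnion \<in> \<sigma>"
      and "a' \<in> carr (set_palg (matchings ` carr alg))" "b' \<in> carr (set_palg (matchings ` carr alg))"
      and c: "djoin (set_palg (matchings ` carr alg)) a' b' = Some c'"
    then obtain a b where ab: "a \<in> carr alg" "b \<in> carr alg" "a' = matchings a" "b' = matchings b"
      unfolding set_palg_def palg.simps by blast
    then have "map_option matchings (djoin alg a b) = Some c'"
      using J[of a b] c by (simp add: set_palg_def)
    then obtain d where "djoin alg a b = Some d" "c' = matchings d"
      unfolding map_option_eq_Some by blast
    then show "c' \<in> carr (set_palg (matchings ` carr alg))"
      using pa s ab(1,2) unfolding partial_algebra_def set_palg_def palg.simps by blast
  next
    fix a' b' c' assume s: "DDiff \<in> \<sigma>"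
      and "a' \<in> carr (set_palg (matchings ` carr alg))" "b' \<in> carr (set_palg (matchings ` carr alg))"
      and c: "dminus (set_palg (matchings ` carr alg)) a' b' = Some c'"
    then obtain a b where ab: "a \<in> carr alg" "b \<in> carr alg" "a' = matchings a" "b' = matchings b"
      unfolding set_palg_def palg.simps by blast
    then have "map_option matchings (dminus alg a b) = Some c'"
      using K[of a b] c by (simp add: set_palg_def)
    then obtain d where "dminus alg a b = Some d" "c' = matchings d"
      unfolding map_option_eq_Some by blast
    then show "c' \<in> carr (set_palg (matchings ` carr alg))"
      using pa s ab(1,2) unfolding partial_algebra_def set_palg_def palg.simps by blast
  next
    assume "Empt \<in> \<sigma>"
    then have "zero alg \<in> carr alg" using pa unfolding partial_algebra_def by blast
    then show "zero (set_palg (matchings ` carr alg)) \<in> carr (set_palg (matchings ` carr alg))"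
      using Z unfolding set_palg_def palg.simps by blast
  qed
  then show ?thesis
    unfolding representation_iff partial_algebra_of_sets_def palg_iso_def
    using inj J K Z by (simp add: bij_betw_def set_palg_def)
qed

text \<open>Representatives \<open>g s\<close> of pairwise combinable elements are mutually
  orthogonal, so even an infinite family fits on one line. The single point of a matching on that
  line decides whether the matching meets the family.\<close>

lemma complete_representation_matchings: "complete_representation \<sigma> alg UNIV matchings"
  unfolding complete_representation_def
proof (intro conjI allI impI representation_matchings)
  fix S a assume S: "S \<subseteq> carr alg" and comb: "pairwise_combinable alg S"
    and sup: "is_supremum alg S a"
  have ub: "s \<subseteq> a" if "s \<in> S" for s
    using sup that by (auto simp: is_supremum_def lesssim_alg)
  have least: "a \<subseteq> b" if "b \<in> carr alg" "\<And>s. s \<in> S \<Longrightarrow> s \<subseteq> b" for b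
    using sup that unfolding is_supremum_def lesssim_alg by blast
  have orthS: "s \<subseteq> perp t" if st: "s \<in> S" "t \<in> S" "s \<noteq> t" for s t
  proof -
    obtain u where "dminus alg u t = Some s"
      using comb st unfolding pairwise_combinable_def by metis
    then show ?thesis by (auto split: if_splits)
  qed
  show "matchings a = (\<Union>s\<in>S. matchings s)"
  proof
    show "(\<Union>s\<in>S. matchings s) \<subseteq> matchings a" using ub by (auto simp: matchings_def)
    show "matchings a \<subseteq> (\<Union>s\<in>S. matchings s)"
    proof (rule subsetI, rule ccontr)
      fix f assume f: "f \<in> matchings a" and miss: "f \<notin> (\<Union>s\<in>S. matchings s)"
      have "\<exists>x. adm x \<and> s = perp (perp x)" if "s \<in> S" for s using S that by auto
      then obtain g where adm_g: "\<And>s. s \<in> S \<Longrightarrow> adm (g s)"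
        and g: "\<And>s. s \<in> S \<Longrightarrow> s = perp (perp (g s))" by metis
      have gs: "g s \<subseteq> s" if "s \<in> S" for s
        using g[OF that] subset_perp_perp[OF adm_subset[OF adm_g[OF that]]] by simp
      have orth_g: "orth p q" if "p \<in> g s" "s \<in> S" "q \<in> g t" "t \<in> S" "p \<noteq> q" for p q s t
      proof (cases "s = t")
        case True
        then show ?thesis using adm_g[OF that(2)] that line_orth by (auto simp: adm_def)
      next
        case False
        then have "t \<subseteq> perp s" using orthS that by blast
        then show ?thesis using gs[OF that(2)] gs[OF that(4)] that perp_orth[of q s p] by blast
      qed
      have "(\<Union>s\<in>S. g s) \<subseteq> P" using adm_g adm_subset by blast
      then obtain L where L: "L \<in> lines" "(\<Union>s\<in>S. g s) \<subseteq> L"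
        using clique_in_line[of "\<Union>s\<in>S. g s"] orth_g by blast
      have fm: "matching f" using f by (simp add: matchings_def)
      obtain p where p: "p \<in> f" "p \<in> L" using matching_lineE[OF fm L(1)] .
      \<comment> \<open>As \<open>f\<close> misses every \<open>s\<close>, the coatom \<open>perp {p}\<close> is an upper bound of \<open>S\<close>.\<close>
      have "s \<subseteq> perp {p}" if "s \<in> S" for s
      proof -
        have "p \<notin> g s" using p(1) miss fm gs[OF that] that by (auto simp: matchings_def)
        then have "{p} \<subseteq> perp (g s)"
          using L p(2) that line_orth[OF L(1)] line_subset[OF L(1)] by (auto simp: perp_def)
        then have "perp (perp (g s)) \<subseteq> perp {p}" by (rule perp_antimono)
        then show ?thesis using g[OF that] by simp
      qed
      moreover have "perp {p} \<in> carr alg"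
        by (rule perp_mem_carr, rule adm_finite[OF L(1)]) (use p in auto)
      ultimately have "a \<subseteq> perp {p}" by (intro least)
      moreover obtain q where "q \<in> f" "q \<in> a" using f by (auto simp: matchings_def)
      ultimately show False using perp_orth[of q "{p}" p] matching_orth[OF fm p(1)] by blast
    qed
  qed
qed

end

section \<open>Matchings extracted from a representation\<close>

context orth_space
begin

abbreviation atom :: "'p \<Rightarrow> 'p set" where
  "atom p \<equiv> perp (perp {p})"

lemma adm_singleton: "p \<in> P \<Longrightarrow> adm {p}"
  using clique_in_line[of "{p}"] by (auto intro: adm_finite)

lemma perp_perp_mem_carr: "adm x \<Longrightarrow> perp (perp x) \<in> carr alg"
  by auto

lemma perp_line: "L \<in> lines \<Longrightarrow> perp L = {}"
  using compatible_on_line[OF _ _ orth_irrefl] by (fastforce simp: perp_def)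

text \<open>The source of all equations about an arbitrary representation: complement belongs to the
  signature, while union and the constant may be absent.\<close>

lemma representation_dminus:
  assumes "representation \<sigma> alg X \<theta>" "DDiff \<in> \<sigma>" "a \<in> carr alg" "b \<in> carr alg" "b \<subseteq> a"
  shows "\<theta> b \<subseteq> \<theta> a" "\<theta> (a \<inter> perp b) = \<theta> a - \<theta> b"
proof -
  obtain S where "palg_iso \<sigma> \<theta> alg (set_palg S)"
    using assms(1) by (auto simp: representation_def)
  then have "map_option \<theta> (dminus alg a b) = subset_complement (\<theta> a) (\<theta> b)"
    using assms(2-4) by (simp add: palg_iso_def set_palg_def del: alg_simps)
  then show "\<theta> b \<subseteq> \<theta> a" "\<theta> (a \<inter> perp b) = \<theta> a - \<theta> b"
    using assms(5) by (auto simp: subset_complement_def split: if_splits)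
qed

text \<open>The empty element is the difference of \<open>P\<close> with itself, so its image is
  empty even when \<open>Empt\<close> is not in the signature.\<close>

lemma representation_bounds:
  assumes "representation \<sigma> alg X \<theta>" "DDiff \<in> \<sigma>" "lines \<noteq> {}"
  shows "P \<in> carr alg" "{} \<in> carr alg" "\<theta> {} = {}"
proof -
  obtain L where L: "L \<in> lines" using assms by blast
  then have adm: "adm {}" by (auto simp: adm_def)
  show P: "P \<in> carr alg" using perp_mem_carr[OF adm] by (simp del: alg_simps)
  show "{} \<in> carr alg" using perp_perp_mem_carr[OF adm] by (simp del: alg_simps)
  show "\<theta> {} = {}"
    using representation_dminus(2)[OF assms(1,2) P P] perp_P by (simp del: alg_simps)
qed

text \<open>On a common line, the join of \<open>p\<close> and \<open>q\<close> minus
  \<open>atom p\<close> is \<open>atom q\<close>. Hence \<open>\<theta> (atom q)\<close> is a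
  complement of \<open>\<theta> (atom p)\<close> in a larger set.\<close>

lemma representation_orth_disjoint:
  assumes rep: "representation \<sigma> alg X \<theta>" "DDiff \<in> \<sigma>" and pq: "p \<in> P" "q \<in> P" "orth p q"
  shows "\<theta> (atom p) \<inter> \<theta> (atom q) = {}"
proof -
  have adm: "adm {p}" "adm {q}" using pq adm_singleton by auto
  moreover have "{p} \<subseteq> perp {q}" using pq orth_sym by (auto simp: perp_def)
  ultimately obtain L where L: "L \<in> lines" "p \<in> L" "q \<in> L" "adm ({p} \<union> {q})"
    using adm_orthogonal_Un by (metis insert_subset)
  let ?a = "perp (perp {p, q})"
  have "p \<noteq> q" using pq orth_irrefl by blast
  have "?a \<inter> perp (atom p) = perp ((L - {p, q}) \<union> {p})"
    using L adm by (simp add: perp_Diff perp_Un del: Un_insert_right Un_insert_left)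
  also have "(L - {p, q}) \<union> {p} = L - {q}" using L \<open>p \<noteq> q\<close> by blast
  also have "perp (L - {q}) = atom q" using L by (simp add: perp_Diff)
  finally have "?a \<inter> perp (atom p) = atom q" .
  moreover have "atom p \<subseteq> ?a" by (intro perp_antimono) auto
  ultimately show ?thesis
    using representation_dminus(2)[OF rep, of ?a "atom p"] L(4) adm(1)
    by (simp add: perp_perp_mem_carr insert_commute del: alg_simps)
qed

text \<open>Peeling off one atom at a time by complement recovers finite unions. Infinite joins are
  out of reach of this induction, which is where completeness takes over.\<close>

lemma representation_finite_join:
  assumes rep: "representation \<sigma> alg X \<theta>" "DDiff \<in> \<sigma>"
    and "finite x" and L: "L \<in> lines" and "x \<subseteq> L"
  shows "\<theta> (perp (perp x)) = (\<Union>p\<in>x. \<theta> (atom p))"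
  using \<open>finite x\<close> \<open>x \<subseteq> L\<close>
proof (induction x rule: finite_induct)
  case empty
  then show ?case using representation_bounds(3)[OF rep] L by auto
next
  case (insert p x)
  let ?a = "perp (perp (insert p x))"
  have pP: "p \<in> P" using insert.prems line_subset[OF L] by blast
  have adm: "adm {p}" "adm (insert p x)"
    using adm_singleton[OF pP] adm_finite[OF L insert.prems] insert.hyps by auto
  have "?a \<inter> perp (atom p) = perp ((L - insert p x) \<union> {p})"
    using L adm insert.prems by (simp add: perp_Diff perp_Un del: Un_insert_right)
  also have "(L - insert p x) \<union> {p} = L - x" using insert by blast
  also have "perp (L - x) = perp (perp x)" using L insert.prems by (simp add: perp_Diff)
  finally have "?a \<inter> perp (atom p) = perp (perp x)" .
  moreover have sub: "atom p \<subseteq> ?a" by (intro perp_antimono) auto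
  ultimately have "\<theta> (perp (perp x)) = \<theta> ?a - \<theta> (atom p)" "\<theta> (atom p) \<subseteq> \<theta> ?a"
    using representation_dminus[OF rep, of ?a "atom p"] adm
    by (simp_all add: perp_perp_mem_carr del: alg_simps)
  then have "\<theta> ?a = \<theta> (atom p) \<union> \<theta> (perp (perp x))" by blast
  then show ?case using insert by auto
qed

text \<open>The atoms of a line are pairwise combinable, since the join of two of them minus one is
  the other, and their supremum is \<open>P\<close>.\<close>

lemma complete_representation_line:
  assumes rep: "complete_representation \<sigma> alg X \<theta>" and L: "L \<in> lines"
  shows "\<theta> P = (\<Union>p\<in>L. \<theta> (atom p))"
proof -
  have adm: "adm {p}" if "p \<in> L" for p
    using adm_singleton line_subset[OF L] that by blast
  have "pairwise_combinable alg (atom ` L)"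
    unfolding pairwise_combinable_def
  proof (intro ballI impI)
    fix s t assume "s \<in> atom ` L" "t \<in> atom ` L" "s \<noteq> t"
    then obtain p q where s: "s = atom p" "p \<in> L" and t: "t = atom q" "q \<in> L" "p \<noteq> q"
      by blast
    let ?a = "perp (perp {p, q})"
    have "adm {p, q}" using adm_finite[OF L] s t by simp
    have "?a \<inter> perp (atom p) = perp ((L - {p, q}) \<union> {p})"
      using L s t adm by (simp add: perp_Diff perp_Un del: Un_insert_right)
    also have "(L - {p, q}) \<union> {p} = L - {q}" using s t by blast
    also have "perp (L - {q}) = atom q" using L t by (simp add: perp_Diff)
    finally have "?a \<inter> perp (atom p) = atom q" .
    moreover have "atom p \<subseteq> ?a" by (intro perp_antimono) auto
    ultimately have "dminus alg ?a s = Some t" using s t by simp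
    then show "\<exists>u\<in>carr alg. dminus alg u s = Some t"
      using perp_perp_mem_carr[OF \<open>adm {p, q}\<close>] by blast
  qed
  moreover have "is_supremum alg (atom ` L) P"
    unfolding is_supremum_def lesssim_alg
  proof (intro conjI ballI impI)
    have "adm {}" using L by (auto simp: adm_def)
    then show "P \<in> carr alg" using perp_mem_carr[of "{}"] by (simp del: alg_simps)
    fix s assume "s \<in> atom ` L"
    then show "s \<subseteq> P" using perp_subset by auto
  next
    fix b assume b: "b \<in> carr alg" "\<forall>s\<in>atom ` L. s \<subseteq> b"
    \<comment> \<open>An upper bound contains every point of the line, so its orthocomplement is
      empty; being closed, it is all of \<open>P\<close>.\<close>
    have "L \<subseteq> b"
      using b(2) subset_perp_perp[of "{_}"] line_subset[OF L] by blast
    then have "perp b = {}" using perp_line[OF L] perp_antimono by blast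
    moreover obtain x where "adm x" "b = perp x" using carr_perpE b(1) by blast
    moreover have "perp (perp (perp x)) = perp x" using \<open>adm x\<close> by simp
    ultimately show "P \<subseteq> b" by simp
  qed
  moreover have "atom ` L \<subseteq> carr alg" using adm perp_perp_mem_carr by blast
  ultimately have "\<theta> P = (\<Union>s\<in>atom ` L. \<theta> s)"
    using rep unfolding complete_representation_def by blast
  then show ?thesis by simp
qed

lemma representation_finite_line:
  assumes "representation \<sigma> alg X \<theta>" "DDiff \<in> \<sigma>" "L \<in> lines" "finite L"
  shows "\<theta> P = (\<Union>p\<in>L. \<theta> (atom p))"
  using representation_finite_join[OF assms(1,2,4,3)] perp_line[OF assms(3)] by simp

text \<open>Injectivity gives a point \<open>w\<close> of \<open>\<theta> P\<close>, and the atoms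
  whose images contain \<open>w\<close> form the matching. The hypothesis \<open>cover\<close>
  isolates the contribution of completeness or finiteness: it prevents \<open>w\<close> from
  avoiding all atoms of a line.\<close>

lemma matching_of_representation:
  assumes rep: "representation \<sigma> alg X \<theta>" "DDiff \<in> \<sigma>" and ne: "P \<noteq> {}" "lines \<noteq> {}"
    and cover: "\<And>L. L \<in> lines \<Longrightarrow> \<theta> P = (\<Union>p\<in>L. \<theta> (atom p))"
  shows "\<exists>f. matching f"
proof -
  have "inj_on \<theta> (carr alg)"
    using rep(1) by (auto simp: representation_def palg_iso_def bij_betw_def)
  then have "\<theta> P \<noteq> \<theta> {}"
    using representation_bounds(1,2)[OF rep ne(2)] ne(1) by (metis inj_on_eq_iff)
  then obtain w where w: "w \<in> \<theta> P" using representation_bounds(3)[OF rep ne(2)] by blast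
  let ?f = "{p \<in> P. w \<in> \<theta> (atom p)}"
  have "\<not> orth p q" if "p \<in> ?f" "q \<in> ?f" for p q
    using representation_orth_disjoint[OF rep, of p q] that by auto
  moreover have "?f \<inter> L \<noteq> {}" if L: "L \<in> lines" for L
  proof -
    obtain p where "p \<in> L" "w \<in> \<theta> (atom p)" using w unfolding cover[OF L] by auto
    then show ?thesis using line_subset[OF L] by auto
  qed
  ultimately have "matching ?f" unfolding matching_def by simp
  then show ?thesis by (rule exI)
qed

end

section \<open>Grids\<close>

text \<open>Inequality of truth values is exclusive or: exactly one coordinate agrees. Cells are
  thus compatible if they are equal or differ in both coordinates.\<close>

definition rook :: "'a \<times> 'b \<Rightarrow> 'a \<times> 'b \<Rightarrow> bool" where
  "rook p q \<longleftrightarrow> (fst p = fst q) \<noteq> (snd p = snd q)"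

definition grid_lines :: "'a set \<Rightarrow> 'b set \<Rightarrow> ('a \<times> 'b) set set" where
  "grid_lines m n = (\<lambda>i. {i} \<times> n) ` m \<union> (\<lambda>j. m \<times> {j}) ` n"

text \<open>Phrased as avoiding two given values, which is how \<open>compatible_on_line\<close>
  uses it: a row must offer a column away from those of two given cells.\<close>

definition at_least3 :: "'a set \<Rightarrow> bool" where
  "at_least3 m \<longleftrightarrow> (\<forall>a b. \<exists>c\<in>m. c \<noteq> a \<and> c \<noteq> b)"

lemma at_least3_infinite: "infinite m \<Longrightarrow> at_least3 m"
  unfolding at_least3_def
proof (intro allI)
  fix a b assume "infinite m"
  then have "infinite (m - {a, b})" by simp
  then show "\<exists>c\<in>m. c \<noteq> a \<and> c \<noteq> b" by (metis Diff_iff ex_in_conv finite.emptyI insert_iff)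
qed

lemma at_least3_card: "3 \<le> card (m :: 'a set) \<Longrightarrow> at_least3 m"
  unfolding at_least3_def
proof (intro allI)
  fix a b :: 'a assume m: "3 \<le> card m"
  have "card {a, b} \<le> 2" by (simp add: card_insert_if)
  then have "\<not> m \<subseteq> {a, b}" using card_mono[of "{a, b}" m] m by auto
  then show "\<exists>c\<in>m. c \<noteq> a \<and> c \<noteq> b" by blast
qed

locale grid =
  fixes m :: "'a set" and n :: "'b set"
  assumes m3: "at_least3 m" and n3: "at_least3 n"
begin

sublocale orth_space "m \<times> n" rook "grid_lines m n"
proof
  fix p q :: "'a \<times> 'b" and L
  assume pq: "p \<in> m \<times> n" "q \<in> m \<times> n" "\<not> rook p q" and "L \<in> grid_lines m n"
  then consider i where "i \<in> m" "L = {i} \<times> n" | j where "j \<in> n" "L = m \<times> {j}"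
    by (auto simp: grid_lines_def)
  then show "\<exists>r\<in>L. \<not> rook r p \<and> \<not> rook r q"
  proof cases
    case (1 i)
    obtain j where "j \<in> n" "j \<noteq> snd p" "j \<noteq> snd q" using n3 unfolding at_least3_def by blast
    \<comment> \<open>If \<open>p\<close> or \<open>q\<close> lies on the row, it serves as its own
      witness. Otherwise \<open>(i, j)\<close> differs from both in both coordinates.\<close>
    then have "p \<in> L \<or> q \<in> L \<or> ((i, j) \<in> L \<and> \<not> rook (i, j) p \<and> \<not> rook (i, j) q)"
      using 1 pq by (cases p; cases q) (auto simp: rook_def)
    then show ?thesis using pq(3) unfolding rook_def by metis
  next
    case (2 j)
    obtain i where "i \<in> m" "i \<noteq> fst p" "i \<noteq> fst q" using m3 unfolding at_least3_def by blast
    then have "p \<in> L \<or> q \<in> L \<or> ((i, j) \<in> L \<and> \<not> rook (i, j) p \<and> \<not> rook (i, j) q)"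
      using 2 pq by (cases p; cases q) (auto simp: rook_def)
    then show ?thesis using pq(3) unfolding rook_def by metis
  qed
next
  fix C :: "('a \<times> 'b) set"
  assume C: "C \<subseteq> m \<times> n" and orth: "\<And>p q. p \<in> C \<Longrightarrow> q \<in> C \<Longrightarrow> p \<noteq> q \<Longrightarrow> rook p q"
  show "\<exists>L\<in>grid_lines m n. C \<subseteq> L"
  proof (cases "C = {}")
    case True
    obtain i where "i \<in> m" using m3 unfolding at_least3_def by blast
    then show ?thesis using True by (auto simp: grid_lines_def)
  next
    case False
    then obtain p where p: "p \<in> C" by blast
    show ?thesis
    proof (cases "C \<subseteq> {fst p} \<times> n")
      case True
      moreover have "{fst p} \<times> n \<in> grid_lines m n" using p C by (auto simp: grid_lines_def)
      ultimately show ?thesis by blast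
    next
      case False
      then obtain q where q: "q \<in> C" "fst q \<noteq> fst p" using C by force
      \<comment> \<open>A clique that leaves the row of \<open>p\<close> has a cell \<open>q\<close>
        in the column of \<open>p\<close>, and a cell orthogonal or equal to both is confined to
        that column.\<close>
      have "snd r = snd p" if r: "r \<in> C" for r
        using orth[OF p q(1)] orth[OF p r] orth[OF q(1) r] q(2) unfolding rook_def by metis
      then have "C \<subseteq> m \<times> {snd p}" using C by force
      moreover have "m \<times> {snd p} \<in> grid_lines m n" using p C by (auto simp: grid_lines_def)
      ultimately show ?thesis by blast
    qed
  qed
next
  fix L L' :: "('a \<times> 'b) set"
  assume L: "L \<in> grid_lines m n" "L' \<in> grid_lines m n" "infinite (L \<inter> L')"
  show "L = L'"
  proof (rule ccontr)
    assume "L \<noteq> L'"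
    then have "\<exists>p. L \<inter> L' \<subseteq> {p}" using L(1,2) by (auto simp: grid_lines_def)
    then show False using L(3) by (meson finite.emptyI finite.insertI finite_subset)
  qed
qed (auto simp: rook_def grid_lines_def)

lemma grid_nonempty: "m \<times> n \<noteq> {}" "grid_lines m n \<noteq> {}"
  using m3 n3 unfolding at_least3_def grid_lines_def by blast+

text \<open>Each column contains a cell of the matching, and no row contains two. An injection from
  \<open>n\<close> to \<open>m\<close> is what fails in both refutations, where \<open>n\<close> is
  the larger side.\<close>

lemma matching_inj:
  assumes "matching f"
  shows "\<exists>g. inj_on g n \<and> g ` n \<subseteq> m"
proof -
  have "\<exists>i. i \<in> m \<and> (i, j) \<in> f" if "j \<in> n" for j
  proof -
    have "m \<times> {j} \<in> grid_lines m n" using that by (simp add: grid_lines_def)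
    then show ?thesis using matching_lineE[OF assms] by (metis SigmaE singletonD)
  qed
  then obtain g where g: "\<And>j. j \<in> n \<Longrightarrow> g j \<in> m \<and> (g j, j) \<in> f" by metis
  have "inj_on g n"
  proof (rule inj_onI)
    fix j k assume jk: "j \<in> n" "k \<in> n" "g j = g k"
    then have "\<not> rook (g j, j) (g k, k)" using matching_orth[OF assms] g by blast
    then show "j = k" using jk(3) by (simp add: rook_def)
  qed
  then show ?thesis using g by blast
qed

lemma complete_representation_inj:
  assumes rep: "complete_representation \<sigma> alg X \<theta>" and "DDiff \<in> \<sigma>"
  shows "\<exists>g. inj_on g n \<and> g ` n \<subseteq> m"
proof -
  have "representation \<sigma> alg X \<theta>" using rep by (simp add: complete_representation_def)
  from matching_of_representation[OF this assms(2) grid_nonempty complete_representation_line[OF rep]]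
  show ?thesis using matching_inj by auto
qed

lemma finite_representation_inj:
  assumes rep: "representation \<sigma> alg X \<theta>" "DDiff \<in> \<sigma>" and "finite m" "finite n"
  shows "\<exists>g. inj_on g n \<and> g ` n \<subseteq> m"
proof -
  have "finite L" if "L \<in> grid_lines m n" for L
    using that assms(3,4) by (auto simp: grid_lines_def)
  with matching_of_representation[OF rep grid_nonempty representation_finite_line[OF rep]]
  show ?thesis using matching_inj by auto
qed

end

section \<open>Square grids: matchings as graphs of permutations\<close>

locale square_grid = grid m m for m :: "'a set"
begin

lemma matching_graph:
  assumes "bij_betw \<pi> m m"
  shows "matching ((\<lambda>i. (i, \<pi> i)) ` m)"
proof -
  have "(\<lambda>i. (i, \<pi> i)) ` m \<inter> L \<noteq> {}" if "L \<in> grid_lines m m" for L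
    using that bij_betw_imp_surj_on[OF assms] bij_betwE[OF assms]
    by (auto simp: grid_lines_def)
  then show ?thesis
    using assms unfolding matching_def bij_betw_def inj_on_def by (auto simp: rook_def)
qed

sublocale matched_orth_space "m \<times> m" rook "grid_lines m m"
proof
  show "grid_lines m m \<noteq> {}" by (rule grid_nonempty)
next
  fix p q assume pq: "p \<in> m \<times> m" "q \<in> m \<times> m" "\<not> rook p q"
  \<comment> \<open>The inner transposition takes \<open>fst p\<close> to \<open>snd p\<close>; the
    outer one corrects the image of \<open>fst q\<close> to \<open>snd q\<close>. It fixes
    \<open>snd p\<close>, because \<open>p\<close> and \<open>q\<close> are equal or differ in both
    coordinates.\<close>
  define \<pi> where "\<pi> = transpose (transpose (fst p) (snd p) (fst q)) (snd q) \<circ> transpose (fst p) (snd p)"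
  have "bij_betw \<pi> m m"
    unfolding \<pi>_def using pq
    by (intro bij_betw_trans[of _ m m]) (auto simp: transpose_def intro!: bij_betw_byWitness[where f' = "transpose _ _"])
  moreover have "\<pi> (fst p) = snd p" "\<pi> (fst q) = snd q"
    using pq(3) by (auto simp: \<pi>_def rook_def transpose_def)
  ultimately show "\<exists>f. matching f \<and> p \<in> f \<and> q \<in> f"
    using matching_graph pq by (intro exI[of _ "(\<lambda>i. (i, \<pi> i)) ` m"]) (auto simp: image_iff)
qed

end

section \<open>The game on sets\<close>

definition capped :: "nat \<Rightarrow> 'a set \<Rightarrow> nat" where
  "capped k A = (if finite A then min k (card A) else k)"

lemma capped_less_iff: "capped k A < k \<longleftrightarrow> finite A \<and> card A < k"
  by (simp add: capped_def min_less_iff_disj)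

lemma capped_subset_exists:
  assumes "i \<le> capped k A"
  shows "\<exists>D\<subseteq>A. finite D \<and> card D = i"
proof (cases "finite A")
  case True
  then have "i \<le> card A" using assms by (simp add: capped_def)
  from obtain_subset_with_card_n[OF this] show ?thesis by blast
next
  case False
  from infinite_arbitrarily_large[OF this] show ?thesis by blast
qed

lemma capped_Diff:
  "finite D \<Longrightarrow> D \<subseteq> A \<Longrightarrow> capped k (A - D) = (if finite A then min k (card A - card D) else k)"
  by (simp add: capped_def card_Diff_subset)

text \<open>Below \<open>2 * k\<close> the sizes of \<open>A\<close> and \<open>B\<close> agree
  exactly; from \<open>2 * k\<close> on, removing at most \<open>k\<close> elements leaves at least
  \<open>k\<close> on both sides. This halving of the threshold is the price of one round.\<close>

lemma capped_split_small:
  assumes eq: "capped (2 * k) A = capped (2 * k) B" and D: "D \<subseteq> A" "finite D" "card D \<le> k"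
  shows "\<exists>D'\<subseteq>B. finite D' \<and> card D' = card D \<and> capped k (A - D) = capped k (B - D')"
proof -
  have "card D \<le> capped (2 * k) A"
    using D card_mono[of A D] by (simp add: capped_def)
  then have "card D \<le> capped (2 * k) B" by (simp add: eq)
  then obtain D' where D': "D' \<subseteq> B" "finite D'" "card D' = card D"
    using capped_subset_exists[of "card D" "2 * k" B] by blast
  have "capped k (A - D) = capped k (B - D')"
  proof (cases "finite A \<and> card A < 2 * k")
    case True
    then have "finite B \<and> card B = card A"
      using eq by (simp add: capped_def min_def split: if_splits)
    then show ?thesis using True D D' by (simp add: capped_Diff)
  next
    case False
    then have B: "finite B \<Longrightarrow> 2 * k \<le> card B"
      using eq by (simp add: capped_def min_def split: if_splits)
    have "capped k (A - D) = k" using False D by (auto simp: capped_Diff intro!: min_absorb1)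
    moreover have "capped k (B - D') = k" using B D D' by (auto simp: capped_Diff intro!: min_absorb1)
    ultimately show ?thesis by simp
  qed
  then show ?thesis using D' by blast
qed

text \<open>Whichever of \<open>D\<close> and \<open>A - D\<close> has fewer than \<open>k\<close>
  elements is copied exactly. If neither has, any part of \<open>B\<close> with at least
  \<open>k\<close> elements inside and outside will do. The answer must also be finite or cofinite
  to denote a legal move.\<close>

lemma capped_split:
  assumes eq: "capped (2 * k) A = capped (2 * k) B" and D: "D \<subseteq> A"
  shows "\<exists>D'\<subseteq>B. capped k D = capped k D' \<and> capped k (A - D) = capped k (B - D') \<and>
    (finite D' \<or> finite (B - D'))"
proof -
  consider "finite D" "card D < k" | "finite (A - D)" "card (A - D) < k"
    | "k \<le> capped k D" "k \<le> capped k (A - D)"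
    using capped_less_iff[of k D] capped_less_iff[of k "A - D"] by linarith
  then show ?thesis
  proof cases
    case 1
    then obtain D' where D': "D' \<subseteq> B" "finite D'" "card D' = card D"
        "capped k (A - D) = capped k (B - D')"
      using capped_split_small[OF eq D] by auto
    then show ?thesis using 1 by (intro exI[of _ D']) (simp add: capped_def)
  next
    case 2
    then obtain D' where D': "D' \<subseteq> B" "finite D'" "card D' = card (A - D)"
        "capped k (A - (A - D)) = capped k (B - D')"
      using capped_split_small[OF eq Diff_subset, of D] by auto
    moreover have "A - (A - D) = D" "B - (B - D') = D'" using D D'(1) by auto
    ultimately show ?thesis using 2 by (intro exI[of _ "B - D'"]) (simp add: capped_def)
  next
    case 3
    \<comment> \<open>Only \<open>k\<close> elements of \<open>D\<close> are imitated, so the answer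
      is finite even when \<open>D\<close> and its complement are infinite.\<close>
    obtain E where E: "E \<subseteq> D" "finite E" "card E = k" using capped_subset_exists[OF 3(1)] by blast
    have "k \<le> capped k (A - E)"
    proof -
      obtain F where F: "F \<subseteq> A - D" "finite F" "card F = k" using capped_subset_exists[OF 3(2)] by blast
      have "F \<subseteq> A - E" using F(1) E(1) by blast
      then show ?thesis using F card_mono[of "A - E" F] by (auto simp: capped_def)
    qed
    then obtain D' where D': "D' \<subseteq> B" "finite D'" "card D' = k"
        "capped k (A - E) = capped k (B - D')"
      using capped_split_small[OF eq, of E] E D by auto
    have "capped k D = k" "capped k (A - D) = k" "capped k (A - E) = k" "capped k D' = k"
      using 3 \<open>k \<le> capped k (A - E)\<close> D' by (auto simp: capped_def)
    then show ?thesis using D' by (intro exI[of _ D']) simp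
  qed
qed

section \<open>Finite and cofinite sets, positions of the game\<close>

definition fincof :: "'a set \<Rightarrow> 'a set \<Rightarrow> bool" where
  "fincof m A \<longleftrightarrow> A \<subseteq> m \<and> (finite A \<or> finite (m - A))"

lemma fincof_Int: "fincof m A \<Longrightarrow> fincof m B \<Longrightarrow> fincof m (A \<inter> B)"
  unfolding fincof_def by (auto simp: Diff_Int)

lemma fincof_Compl: "fincof m A \<Longrightarrow> fincof m (m - A)"
  unfolding fincof_def by (auto simp: double_diff)

lemma fincof_Diff:
  assumes "fincof m A" "fincof m B" shows "fincof m (A - B)"
proof -
  have "A - B = A \<inter> (m - B)" using assms(1) by (auto simp: fincof_def)
  then show ?thesis using fincof_Int[OF assms(1) fincof_Compl[OF assms(2)]] by simp
qed

definition cell :: "'a set \<Rightarrow> ('a \<Rightarrow> 'c) \<Rightarrow> 'c \<Rightarrow> 'a set" where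
  "cell m l c = {x \<in> m. l x = c}"

text \<open>A position of the game on sets with \<open>r\<close> rounds to go: both sides are split into cells labelled by
  the answers to the previous rounds, corresponding cells have the same size up to \<open>2 ^ Suc r\<close>, and the
  sets played so far are unions of corresponding cells.\<close>

definition set_sim :: "nat \<Rightarrow> 'a set \<Rightarrow> 'b set \<Rightarrow> (nat \<Rightarrow> 'a set) \<Rightarrow> (nat \<Rightarrow> 'b set) \<Rightarrow> bool" where
  "set_sim r m m' e e' \<longleftrightarrow> (\<exists>(l :: 'a \<Rightarrow> bool list) (l' :: 'b \<Rightarrow> bool list) Q C.
     finite C \<and> l ` m \<subseteq> C \<and> l' ` m' \<subseteq> C \<and>
     (\<forall>c. fincof m (cell m l c) \<and> fincof m' (cell m' l' c) \<and>
        capped (2 ^ Suc r) (cell m l c) = capped (2 ^ Suc r) (cell m' l' c)) \<and>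
     (\<forall>k. e k = {x \<in> m. l x \<in> Q k} \<and> e' k = {x \<in> m'. l' x \<in> Q k}))"

lemma set_simI:
  fixes l :: "'a \<Rightarrow> bool list" and l' :: "'b \<Rightarrow> bool list"
  assumes "finite C" "l ` m \<subseteq> C" "l' ` m' \<subseteq> C"
    and "\<And>c. fincof m (cell m l c)" "\<And>c. fincof m' (cell m' l' c)"
    and "\<And>c. capped (2 ^ Suc r) (cell m l c) = capped (2 ^ Suc r) (cell m' l' c)"
    and "\<And>k. e k = {x \<in> m. l x \<in> Q k}" "\<And>k. e' k = {x \<in> m'. l' x \<in> Q k}"
  shows "set_sim r m m' e e'"
  unfolding set_sim_def by (intro exI conjI allI) (fact assms)+

lemma set_simE:
  assumes "set_sim r m m' e e'"
  obtains l :: "'a \<Rightarrow> bool list" and l' :: "'b \<Rightarrow> bool list" and Q C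
  where "finite C" "l ` m \<subseteq> C" "l' ` m' \<subseteq> C"
    and "\<And>c. fincof m (cell m l c)" "\<And>c. fincof m' (cell m' l' c)"
    and "\<And>c. capped (2 ^ Suc r) (cell m l c) = capped (2 ^ Suc r) (cell m' l' c)"
    and "\<And>k. e k = {x \<in> m. l x \<in> Q k}" "\<And>k. e' k = {x \<in> m'. l' x \<in> Q k}"
proof -
  obtain l :: "'a \<Rightarrow> bool list" and l' :: "'b \<Rightarrow> bool list" and Q C
    where *: "finite C" "l ` m \<subseteq> C" "l' ` m' \<subseteq> C"
     "\<forall>c. fincof m (cell m l c) \<and> fincof m' (cell m' l' c) \<and>
        capped (2 ^ Suc r) (cell m l c) = capped (2 ^ Suc r) (cell m' l' c)"
     "\<forall>k. e k = {x \<in> m. l x \<in> Q k} \<and> e' k = {x \<in> m'. l' x \<in> Q k}"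
    using assms unfolding set_sim_def by (elim exE conjE)
  from *(4,5) show thesis by (intro that[OF *(1-3)]) simp_all
qed

lemma set_sim_sym:
  assumes "set_sim r m m' e e'" shows "set_sim r m' m e' e"
proof -
  from assms obtain l :: "'a \<Rightarrow> bool list" and l' :: "'b \<Rightarrow> bool list" and Q C
    where "finite C" "l ` m \<subseteq> C" "l' ` m' \<subseteq> C"
      and "\<And>c. fincof m (cell m l c)" "\<And>c. fincof m' (cell m' l' c)"
      and cap: "\<And>c. capped (2 ^ Suc r) (cell m l c) = capped (2 ^ Suc r) (cell m' l' c)"
      and "\<And>k. e k = {x \<in> m. l x \<in> Q k}" "\<And>k. e' k = {x \<in> m'. l' x \<in> Q k}"
    by (rule set_simE) blast
  then show ?thesis
    by (intro set_simI[of C l' m' l m r e' Q e]) (simp_all only: cap)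
qed

lemma set_sim_initial:
  assumes "capped (2 ^ Suc r) m = capped (2 ^ Suc r) m'"
  shows "set_sim r m m' (\<lambda>_. {}) (\<lambda>_. {})"
proof (rule set_simI[where l = "\<lambda>_. []" and l' = "\<lambda>_. []" and C = "{[]}" and Q = "\<lambda>_. {}"])
  fix c :: "bool list"
  show "capped (2 ^ Suc r) (cell m (\<lambda>_. []) c) = capped (2 ^ Suc r) (cell m' (\<lambda>_. []) c)"
    using assms by (cases c) (simp_all add: cell_def capped_def)
next
  show "fincof m (cell m (\<lambda>_. []) c)" "fincof m' (cell m' (\<lambda>_. []) c)" for c :: "bool list"
    by (cases c; simp add: cell_def fincof_def)+
qed (auto simp: cell_def)

text \<open>The move \<open>A\<close> cuts every cell in two, and \<open>capped_split\<close>
  answers in each corresponding cell independently. Thresholds drop from \<open>2 * ?N\<close> to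
  \<open>?N\<close>.\<close>

lemma set_sim_extend:
  assumes sim: "set_sim (Suc r) m m' e e'" and A: "fincof m A"
  shows "\<exists>A'. fincof m' A' \<and> set_sim r m m' (e(k := A)) (e'(k := A'))"
proof -
  let ?N = "2 ^ Suc r :: nat"
  obtain l :: "'a \<Rightarrow> bool list" and l' :: "'b \<Rightarrow> bool list" and Q C
    where C: "finite C" "l ` m \<subseteq> C" "l' ` m' \<subseteq> C"
      and fc: "\<And>c. fincof m (cell m l c)" "\<And>c. fincof m' (cell m' l' c)"
      and cap: "\<And>c. capped (2 * ?N) (cell m l c) = capped (2 * ?N) (cell m' l' c)"
      and e: "\<And>i. e i = {x \<in> m. l x \<in> Q i}" "\<And>i. e' i = {x \<in> m'. l' x \<in> Q i}"
    using sim by (rule set_simE) (unfold power_Suc[of 2 "Suc r"], blast)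
  have "\<exists>D\<subseteq>cell m' l' c. capped ?N (cell m l c \<inter> A) = capped ?N D \<and>
      capped ?N (cell m l c - A) = capped ?N (cell m' l' c - D) \<and>
      (finite D \<or> finite (cell m' l' c - D))" for c
    using capped_split[OF cap, of "cell m l c \<inter> A" c] by (simp add: Diff_Int)
  then obtain D where D: "\<And>c. D c \<subseteq> cell m' l' c"
      "\<And>c. capped ?N (cell m l c \<inter> A) = capped ?N (D c)"
      "\<And>c. capped ?N (cell m l c - A) = capped ?N (cell m' l' c - D c)"
      "\<And>c. finite (D c) \<or> finite (cell m' l' c - D c)"
    by metis
  define A' where "A' = (\<Union>c. D c)"
  have A'_cell: "cell m' l' c \<inter> A' = D c" for c
    using D(1) unfolding A'_def cell_def by blast
  have A'_sub: "A' \<subseteq> m'" using D(1) unfolding A'_def cell_def by blast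
  \<comment> \<open>There are only finitely many nonempty cells. Either all answers are finite,
    hence so is their union, or one is infinite; its cell is then cofinite in \<open>m'\<close>, and
    the answer is cofinite in that cell.\<close>
  have fA': "fincof m' A'"
  proof (cases "\<forall>c. finite (D c)")
    case True
    have "D c = {}" if "c \<notin> C" for c using D(1)[of c] that C(3) unfolding cell_def by blast
    then have "A' = (\<Union>c\<in>C. D c)" unfolding A'_def by blast
    then show ?thesis using True C(1) A'_sub unfolding fincof_def by simp
  next
    case False
    then obtain c where inf: "infinite (D c)" by blast
    then have "infinite (cell m' l' c)" using D(1) finite_subset by blast
    then have "finite (m' - cell m' l' c)" using fc(2)[of c] unfolding fincof_def by blast
    moreover have "finite (cell m' l' c - D c)" using D(4) inf by blast
    moreover have "m' - A' \<subseteq> (m' - cell m' l' c) \<union> (cell m' l' c - D c)"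
      unfolding A'_def by blast
    ultimately have "finite (m' - A')" by (meson finite_UnI finite_subset)
    then show ?thesis using A'_sub unfolding fincof_def by blast
  qed
  \<comment> \<open>The new answer is put at the head of each label: the set just played is read off
    from \<open>hd\<close>, earlier sets from \<open>tl\<close>. No point carries the label
    \<open>[]\<close> any more, so \<open>hd []\<close> does no harm.\<close>
  let ?l = "\<lambda>x. (x \<in> A) # l x" and ?l' = "\<lambda>x. (x \<in> A') # l' x"
  let ?Q = "\<lambda>i. if i = k then {d. hd d} else {d. tl d \<in> Q i}"
  let ?C = "(\<lambda>(b, c). b # c) ` (UNIV \<times> C)"
  have cell_True: "cell m ?l (True # c) = cell m l c \<inter> A" "cell m' ?l' (True # c) = D c" for c
    using A'_cell[of c] by (auto simp: cell_def)
  have cell_False: "cell m ?l (False # c) = cell m l c - A"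
      "cell m' ?l' (False # c) = cell m' l' c - D c" for c
    using A'_cell[of c] by (auto simp: cell_def)
  have cell_Nil: "cell m ?l [] = {}" "cell m' ?l' [] = {}" by (auto simp: cell_def)
  have fD: "fincof m' (D c)" for c using fincof_Int[OF fc(2) fA'] A'_cell by metis
  have "set_sim r m m' (e(k := A)) (e'(k := A'))"
  proof (rule set_simI[where l = ?l and l' = ?l' and C = ?C and Q = ?Q])
    fix c
    show "fincof m (cell m ?l c)"
    proof (cases c)
      case (Cons b d)
      then show ?thesis
        using fincof_Int[OF fc(1)[of d] A] fincof_Diff[OF fc(1)[of d] A]
        by (cases b) (simp_all only: cell_True cell_False)
    qed (simp add: cell_Nil fincof_def)
    show "fincof m' (cell m' ?l' c)"
    proof (cases c)
      case (Cons b d)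
      then show ?thesis
        using fD[of d] fincof_Diff[OF fc(2) fD, of d d]
        by (cases b) (simp_all only: cell_True cell_False)
    qed (simp add: cell_Nil fincof_def)
    show "capped ?N (cell m ?l c) = capped ?N (cell m' ?l' c)"
    proof (cases c)
      case (Cons b d)
      then show ?thesis
        using D(2,3)[of d] by (cases b) (simp_all only: cell_True cell_False)
    qed (simp add: cell_Nil capped_def)
  next
    fix i
    show "(e(k := A)) i = {x \<in> m. ?l x \<in> ?Q i}" "(e'(k := A')) i = {x \<in> m'. ?l' x \<in> ?Q i}"
      using A A'_sub e by (auto simp: fincof_def)
  qed (use C in \<open>auto simp: image_iff\<close>)
  then show ?thesis using fA' by blast
qed

section \<open>What truncated sizes determine\<close>

lemma capped_empty_iff: "0 < k \<Longrightarrow> A = {} \<longleftrightarrow> capped k A = 0"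
  by (cases "finite A") (auto simp: capped_def min_def)

lemma capped_singleton_iff:
  assumes "2 \<le> k"
  shows "(\<forall>x\<in>A. \<forall>y\<in>A. x = y) \<longleftrightarrow> capped k A \<le> 1"
proof
  assume "\<forall>x\<in>A. \<forall>y\<in>A. x = y"
  then have "A = {} \<or> (\<exists>x. A = {x})" by blast
  then show "capped k A \<le> 1" by (auto simp: capped_def)
next
  assume "capped k A \<le> 1"
  then have "finite A" "card A \<le> 1" using assms by (auto simp: capped_def split: if_splits)
  then show "\<forall>x\<in>A. \<forall>y\<in>A. x = y" by (simp add: card_le_Suc0_iff_eq)
qed

lemma set_sim_meet:
  assumes "set_sim r m m' e e'"
  shows "e i \<inter> e j = {} \<longleftrightarrow> e' i \<inter> e' j = {}"
proof -
  obtain l :: "'a \<Rightarrow> bool list" and l' :: "'b \<Rightarrow> bool list" and Q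
    where cap: "\<And>c. capped (2 ^ Suc r) (cell m l c) = capped (2 ^ Suc r) (cell m' l' c)"
      and e: "\<And>i. e i = {x \<in> m. l x \<in> Q i}" "\<And>i. e' i = {x \<in> m'. l' x \<in> Q i}"
    using assms by (rule set_simE) blast
  have "cell m l c = {} \<longleftrightarrow> cell m' l' c = {}" for c
    using cap[of c] capped_empty_iff[of "2 ^ Suc r" "cell m l c"]
      capped_empty_iff[of "2 ^ Suc r" "cell m' l' c"] by simp
  moreover have "e i \<inter> e j = {} \<longleftrightarrow> (\<forall>c\<in>Q i \<inter> Q j. cell m l c = {})"
      "e' i \<inter> e' j = {} \<longleftrightarrow> (\<forall>c\<in>Q i \<inter> Q j. cell m' l' c = {})"
    unfolding e cell_def by blast+
  ultimately show ?thesis by simp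
qed

text \<open>Distinct points come from two different nonempty cells or from one cell with two points.
  The exponent \<open>Suc r\<close> keeps the threshold at 2 or more even when no rounds remain, so
  both cases are visible.\<close>

lemma set_sim_distinct:
  assumes "set_sim r m m' e e'"
  shows "(\<exists>x\<in>e i. \<exists>y\<in>e j. x \<noteq> y) \<longleftrightarrow> (\<exists>x\<in>e' i. \<exists>y\<in>e' j. x \<noteq> y)"
proof -
  obtain l :: "'a \<Rightarrow> bool list" and l' :: "'b \<Rightarrow> bool list" and Q
    where cap: "\<And>c. capped (2 ^ Suc r) (cell m l c) = capped (2 ^ Suc r) (cell m' l' c)"
      and e: "\<And>i. e i = {x \<in> m. l x \<in> Q i}" "\<And>i. e' i = {x \<in> m'. l' x \<in> Q i}"
    using assms by (rule set_simE) blast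
  have 2: "(2::nat) \<le> 2 ^ Suc r" by simp
  have ne: "cell m l c = {} \<longleftrightarrow> cell m' l' c = {}" for c
    using cap[of c] capped_empty_iff[of "2 ^ Suc r" "cell m l c"]
      capped_empty_iff[of "2 ^ Suc r" "cell m' l' c"] by simp
  have small: "(\<forall>x\<in>cell m l c. \<forall>y\<in>cell m l c. x = y) \<longleftrightarrow>
      (\<forall>x\<in>cell m' l' c. \<forall>y\<in>cell m' l' c. x = y)" for c
    unfolding capped_singleton_iff[OF 2] cap by (rule refl)
  have split: "(\<exists>x\<in>{x \<in> S. h x \<in> Q i}. \<exists>y\<in>{x \<in> S. h x \<in> Q j}. x \<noteq> y) \<longleftrightarrow>
      (\<exists>c\<in>Q i. \<exists>d\<in>Q j. c \<noteq> d \<and> cell S h c \<noteq> {} \<and> cell S h d \<noteq> {}) \<or>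
      (\<exists>c\<in>Q i \<inter> Q j. \<not> (\<forall>x\<in>cell S h c. \<forall>y\<in>cell S h c. x = y))" (is "?lhs \<longleftrightarrow> ?rhs")
    for S :: "'s set" and h
  proof
    assume ?lhs
    then obtain x y where xy: "x \<in> S" "h x \<in> Q i" "y \<in> S" "h y \<in> Q j" "x \<noteq> y" by blast
    then have "x \<in> cell S h (h x)" "y \<in> cell S h (h y)" by (simp_all add: cell_def)
    then show ?rhs using xy by (cases "h x = h y") (metis IntI, metis empty_iff)
  next
    assume ?rhs
    then show ?lhs
    proof (elim disjE bexE)
      fix c d assume "c \<in> Q i" "d \<in> Q j" and cd: "c \<noteq> d \<and> cell S h c \<noteq> {} \<and> cell S h d \<noteq> {}"
      moreover obtain x y where "x \<in> cell S h c" "y \<in> cell S h d" using cd by blast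
      ultimately have "x \<in> {x \<in> S. h x \<in> Q i}" "y \<in> {x \<in> S. h x \<in> Q j}" "x \<noteq> y"
        by (auto simp: cell_def)
      then show ?lhs by blast
    next
      fix c assume c: "c \<in> Q i \<inter> Q j" and "\<not> (\<forall>x\<in>cell S h c. \<forall>y\<in>cell S h c. x = y)"
      then obtain x y where "x \<in> cell S h c" "y \<in> cell S h c" "x \<noteq> y" by blast
      then have "x \<in> {x \<in> S. h x \<in> Q i}" "y \<in> {x \<in> S. h x \<in> Q j}" "x \<noteq> y"
        using c by (auto simp: cell_def)
      then show ?lhs by blast
    qed
  qed
  show ?thesis unfolding e split ne small by (rule refl)
qed

section \<open>The game on grid algebras\<close>

definition small :: "'a set \<Rightarrow> bool" where
  "small A \<longleftrightarrow> (\<forall>x\<in>A. \<forall>y\<in>A. x = y)"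

text \<open>\<open>small\<close> admits the empty set besides singletons. An element can have
  several codes: every full row and every full column denotes \<open>P\<close>. Equality of elements
  therefore becomes \<open>code_le\<close> in both directions.\<close>

definition code :: "'a set \<Rightarrow> 'b set \<Rightarrow> 'a set \<times> 'b set \<Rightarrow> bool" where
  "code m n x \<longleftrightarrow> fincof m (fst x) \<and> fincof n (snd x) \<and> (small (fst x) \<or> small (snd x))"

text \<open>An element of the grid algebra is played as a rectangle contained in a row or a column. The
  operations become first-order definable from orthogonality of rectangles.\<close>

definition box :: "'a set \<times> 'b set \<Rightarrow> ('a \<times> 'b) set" where
  "box x = fst x \<times> snd x"

definition box_orth :: "'a set \<times> 'b set \<Rightarrow> 'a set \<times> 'b set \<Rightarrow> bool" where
  "box_orth x y \<longleftrightarrow> (\<forall>p\<in>box x. \<forall>q\<in>box y. rook p q)"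

text \<open>Inclusion of closed sets, tested by orthogonality to rectangles. The quantifier over
  \<open>z\<close> costs one round of the game.\<close>

definition code_le :: "'a set \<Rightarrow> 'b set \<Rightarrow> 'a set \<times> 'b set \<Rightarrow> 'a set \<times> 'b set \<Rightarrow> bool" where
  "code_le m n x y \<longleftrightarrow> (\<forall>z. code m n z \<longrightarrow> box_orth y z \<longrightarrow> box_orth x z)"

definition code_join ::
    "'a set \<Rightarrow> 'b set \<Rightarrow> 'a set \<times> 'b set \<Rightarrow> 'a set \<times> 'b set \<Rightarrow> 'a set \<times> 'b set \<Rightarrow> bool" where
  "code_join m n x y z \<longleftrightarrow> box_orth x y \<and>
     (\<forall>u. code m n u \<longrightarrow> (box_orth z u \<longleftrightarrow> box_orth x u \<and> box_orth y u))"

text \<open>The difference is determined by the elements below it. The quantifier over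
  \<open>u\<close> encloses the one inside \<open>code_le\<close>, so this relation costs two
  rounds.\<close>

definition code_minus ::
    "'a set \<Rightarrow> 'b set \<Rightarrow> 'a set \<times> 'b set \<Rightarrow> 'a set \<times> 'b set \<Rightarrow> 'a set \<times> 'b set \<Rightarrow> bool" where
  "code_minus m n x y z \<longleftrightarrow> code_le m n y x \<and>
     (\<forall>u. code m n u \<longrightarrow> (code_le m n u z \<longleftrightarrow> code_le m n u x \<and> box_orth y u))"

text \<open>Two set games run side by side, one for each coordinate, with a common number of
  remaining rounds.\<close>

definition code_sim :: "nat \<Rightarrow> 'a set \<Rightarrow> 'b set \<Rightarrow> 'c set \<Rightarrow> 'd set \<Rightarrow>
    (nat \<Rightarrow> 'a set \<times> 'b set) \<Rightarrow> (nat \<Rightarrow> 'c set \<times> 'd set) \<Rightarrow> bool" where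
  "code_sim r m n m' n' e e' \<longleftrightarrow>
     set_sim r m m' (\<lambda>k. fst (e k)) (\<lambda>k. fst (e' k)) \<and>
     set_sim r n n' (\<lambda>k. snd (e k)) (\<lambda>k. snd (e' k)) \<and>
     (\<forall>k. code m n (e k)) \<and> (\<forall>k. code m' n' (e' k))"

lemma code_sim_sym: "code_sim r m n m' n' e e' \<Longrightarrow> code_sim r m' n' m n e' e"
  by (simp add: code_sim_def set_sim_sym)

lemma set_sim_small:
  assumes "set_sim r m m' e e'" shows "small (e i) \<longleftrightarrow> small (e' i)"
  using set_sim_distinct[OF assms, of i i] by (auto simp: small_def)

lemma fun_upd_fst: "(\<lambda>k. fst ((e(i := x)) k)) = (\<lambda>k. fst (e k))(i := fst x)"
  and fun_upd_snd: "(\<lambda>k. snd ((e(i := x)) k)) = (\<lambda>k. snd (e k))(i := snd x)"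
  by auto

text \<open>The factors are answered independently. The pair is again a code because the set game
  preserves \<open>small\<close>.\<close>

lemma code_sim_extend:
  assumes sim: "code_sim (Suc r) m n m' n' e e'" and x: "code m n x"
  obtains x' where "code m' n' x'" "code_sim r m n m' n' (e(k := x)) (e'(k := x'))"
proof -
  obtain A where A: "fincof m' A"
      "set_sim r m m' ((\<lambda>i. fst (e i))(k := fst x)) ((\<lambda>i. fst (e' i))(k := A))"
    using set_sim_extend sim x unfolding code_sim_def code_def by metis
  obtain B where B: "fincof n' B"
      "set_sim r n n' ((\<lambda>i. snd (e i))(k := snd x)) ((\<lambda>i. snd (e' i))(k := B))"
    using set_sim_extend sim x unfolding code_sim_def code_def by metis
  have "code m' n' (A, B)"
    using x A(1) B(1) set_sim_small[OF A(2), of k] set_sim_small[OF B(2), of k]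
    by (simp add: code_def)
  moreover from this have "code_sim r m n m' n' (e(k := x)) (e'(k := (A, B)))"
    using sim x A(2) B(2) unfolding code_sim_def fun_upd_fst fun_upd_snd by simp
  ultimately show thesis by (rule that)
qed

text \<open>Two cells fail to be orthogonal by agreeing in both coordinates or by differing in both.
  For rectangles each failure is a conjunction of conditions on single factors, which lets the
  coordinates be played separately.\<close>

lemma box_orth_iff: "box_orth x y \<longleftrightarrow>
    (fst x \<inter> fst y = {} \<or> snd x \<inter> snd y = {}) \<and>
    \<not> ((\<exists>a\<in>fst x. \<exists>b\<in>fst y. a \<noteq> b) \<and> (\<exists>a\<in>snd x. \<exists>b\<in>snd y. a \<noteq> b))"
  unfolding box_orth_def box_def rook_def by fastforce

lemma box_orth_sim:
  assumes "code_sim r m n m' n' e e'"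
  shows "box_orth (e i) (e j) \<longleftrightarrow> box_orth (e' i) (e' j)"
proof -
  have 1: "set_sim r m m' (\<lambda>k. fst (e k)) (\<lambda>k. fst (e' k))"
    and 2: "set_sim r n n' (\<lambda>k. snd (e k)) (\<lambda>k. snd (e' k))"
    using assms by (simp_all add: code_sim_def)
  show ?thesis
    unfolding box_orth_iff
    by (simp only: set_sim_meet[OF 1] set_sim_meet[OF 2] set_sim_distinct[OF 1] set_sim_distinct[OF 2])
qed

text \<open>The test rectangle is played as one further move on the primed side, and its answer is
  tested on the other side. The symmetry of \<open>code_sim\<close> yields the converse.\<close>

lemma code_le_sim_imp:
  assumes sim: "code_sim (Suc r) m n m' n' e e'" and le: "code_le m n (e i) (e j)"
  shows "code_le m' n' (e' i) (e' j)"
  unfolding code_le_def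
proof (intro allI impI)
  fix z' assume z': "code m' n' z'" "box_orth (e' j) z'"
  \<comment> \<open>An index different from \<open>i\<close> and \<open>j\<close>, so that recording
    the test rectangle overwrites neither.\<close>
  define k where "k = Suc (i + j)"
  have k: "i \<noteq> k" "j \<noteq> k" by (simp_all add: k_def)
  obtain z where z: "code m n z" "code_sim r m' n' m n (e'(k := z')) (e(k := z))"
    using code_sim_extend[OF code_sim_sym[OF sim] z'(1)] by blast
  have "box_orth (e j) z"
    using box_orth_sim[OF z(2), of j k] z'(2) k by simp
  then have "box_orth (e i) z" using le z(1) unfolding code_le_def by blast
  then show "box_orth (e' i) z'"
    using box_orth_sim[OF z(2), of i k] k by simp
qed

lemma code_le_sim:
  "code_sim (Suc r) m n m' n' e e' \<Longrightarrow> code_le m n (e i) (e j) \<longleftrightarrow> code_le m' n' (e' i) (e' j)"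
  using code_le_sim_imp code_sim_sym by metis

lemma code_join_sim_imp:
  assumes sim: "code_sim (Suc r) m n m' n' e e'" and J: "code_join m n (e i) (e j) (e l)"
  shows "code_join m' n' (e' i) (e' j) (e' l)"
  unfolding code_join_def
proof (intro conjI allI impI)
  show "box_orth (e' i) (e' j)"
    using J box_orth_sim[OF sim] by (simp add: code_join_def)
  fix u' assume u': "code m' n' u'"
  define k where "k = Suc (i + j + l)"
  have k: "i \<noteq> k" "j \<noteq> k" "l \<noteq> k" by (simp_all add: k_def)
  obtain u where u: "code m n u" "code_sim r m' n' m n (e'(k := u')) (e(k := u))"
    using code_sim_extend[OF code_sim_sym[OF sim] u'] by blast
  have "box_orth (e l) u \<longleftrightarrow> box_orth (e i) u \<and> box_orth (e j) u"
    using J u(1) unfolding code_join_def by blast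
  then show "box_orth (e' l) u' \<longleftrightarrow> box_orth (e' i) u' \<and> box_orth (e' j) u'"
    using box_orth_sim[OF u(2), of l k] box_orth_sim[OF u(2), of i k] box_orth_sim[OF u(2), of j k] k
    by simp
qed

lemma code_join_sim:
  "code_sim (Suc r) m n m' n' e e' \<Longrightarrow>
    code_join m n (e i) (e j) (e l) \<longleftrightarrow> code_join m' n' (e' i) (e' j) (e' l)"
  using code_join_sim_imp code_sim_sym by metis

lemma code_minus_sim_imp:
  assumes sim: "code_sim (Suc (Suc r)) m n m' n' e e'" and K: "code_minus m n (e i) (e j) (e l)"
  shows "code_minus m' n' (e' i) (e' j) (e' l)"
  unfolding code_minus_def
proof (intro conjI allI impI)
  show "code_le m' n' (e' j) (e' i)"
    using K code_le_sim[OF sim] by (simp add: code_minus_def)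
  fix u' assume u': "code m' n' u'"
  define k where "k = Suc (i + j + l)"
  have k: "i \<noteq> k" "j \<noteq> k" "l \<noteq> k" by (simp_all add: k_def)
  obtain u where u: "code m n u" "code_sim (Suc r) m' n' m n (e'(k := u')) (e(k := u))"
    using code_sim_extend[OF code_sim_sym[OF sim] u'] by blast
  have "code_le m n u (e l) \<longleftrightarrow> code_le m n u (e i) \<and> box_orth (e j) u"
    using K u(1) unfolding code_minus_def by blast
  then show "code_le m' n' u' (e' l) \<longleftrightarrow> code_le m' n' u' (e' i) \<and> box_orth (e' j) u'"
    using code_le_sim[OF u(2), of k l] code_le_sim[OF u(2), of k i] box_orth_sim[OF u(2), of j k] k
    by simp
qed

lemma code_minus_sim:
  "code_sim (Suc (Suc r)) m n m' n' e e' \<Longrightarrow>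
    code_minus m n (e i) (e j) (e l) \<longleftrightarrow> code_minus m' n' (e' i) (e' j) (e' l)"
  using code_minus_sim_imp code_sim_sym by metis

section \<open>Codes as names of elements\<close>

context grid
begin

definition decode :: "'a set \<times> 'b set \<Rightarrow> ('a \<times> 'b) set" where
  "decode x = perp (perp (box x))"

lemma code_box_subset: "code m n x \<Longrightarrow> box x \<subseteq> m \<times> n"
  by (auto simp: code_def fincof_def box_def)

lemma code_adm:
  assumes "code m n x" shows "adm (box x)"
proof -
  obtain A B where x: "x = (A, B)" by (cases x)
  have AB: "fincof m A" "fincof n B" "small A \<or> small B" using assms by (simp_all add: x code_def)
  show ?thesis
  proof (cases "A = {} \<or> B = {}")
    case True
    then have "box x = {}" by (auto simp: x box_def)
    moreover obtain L where "L \<in> grid_lines m n" using grid_nonempty by blast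
    ultimately show ?thesis by (auto simp: adm_def)
  next
    case False
    then obtain i j where ij: "i \<in> A" "j \<in> B" by blast
    show ?thesis
      using AB(3)
    proof
      assume "small A"
      then have A: "A = {i}" using ij by (auto simp: small_def)
      have "{i} \<times> n \<in> grid_lines m n" using AB(1) ij by (auto simp: grid_lines_def fincof_def)
      moreover have "{i} \<times> n - {i} \<times> B = {i} \<times> (n - B)" by auto
      ultimately show ?thesis
        using AB(2) by (auto simp: adm_def fincof_def x box_def A intro!: bexI[of _ "{i} \<times> n"])
    next
      assume "small B"
      then have B: "B = {j}" using ij by (auto simp: small_def)
      have "m \<times> {j} \<in> grid_lines m n" using AB(2) ij by (auto simp: grid_lines_def fincof_def)
      moreover have "m \<times> {j} - A \<times> {j} = (m - A) \<times> {j}" by auto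
      ultimately show ?thesis
        using AB(1) by (auto simp: adm_def fincof_def x box_def B intro!: bexI[of _ "m \<times> {j}"])
    qed
  qed
qed

lemma adm_code:
  assumes "adm x" obtains c where "code m n c" "box c = x"
proof -
  obtain L where L: "L \<in> grid_lines m n" "x \<subseteq> L" "finite x \<or> finite (L - x)"
    using assms unfolding adm_def by blast
  from L(1) consider i where "i \<in> m" "L = {i} \<times> n" | j where "j \<in> n" "L = m \<times> {j}"
    unfolding grid_lines_def by blast
  then show thesis
  proof cases
    case (1 i)
    then have "box ({i}, snd ` x) = x" using L(2) by (force simp: box_def)
    moreover have "n - snd ` x \<subseteq> snd ` (L - x)" using 1 L(2) by force
    then have "fincof n (snd ` x)"
      using L(2,3) 1 finite_surj[of "L - x" "n - snd ` x" snd] by (auto simp: fincof_def)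
    moreover have "fincof m {i}" using 1 by (simp add: fincof_def)
    ultimately show thesis using that[of "({i}, snd ` x)"] by (simp add: code_def small_def)
  next
    case (2 j)
    then have "box (fst ` x, {j}) = x" using L(2) by (force simp: box_def)
    moreover have "m - fst ` x \<subseteq> fst ` (L - x)" using 2 L(2) by force
    then have "fincof m (fst ` x)"
      using L(2,3) 2 finite_surj[of "L - x" "m - fst ` x" fst] by (auto simp: fincof_def)
    moreover have "fincof n {j}" using 2 by (simp add: fincof_def)
    ultimately show thesis using that[of "(fst ` x, {j})"] by (simp add: code_def small_def)
  qed
qed

lemma carr_decode: "carr alg = decode ` {x. code m n x}"
proof
  show "carr alg \<subseteq> decode ` {x. code m n x}"
  proof
    fix a assume "a \<in> carr alg"
    then obtain x where x: "adm x" "a = perp (perp x)" by (rule carrE)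
    obtain c where "code m n c" "box c = x" using adm_code[OF x(1)] .
    then show "a \<in> decode ` {x. code m n x}" using x(2) by (auto simp: decode_def)
  qed
  show "decode ` {x. code m n x} \<subseteq> carr alg"
    using code_adm perp_perp_mem_carr by (auto simp: decode_def simp del: alg_simps)
qed

lemma code_point:
  assumes "p \<in> m \<times> n" shows "code m n ({fst p}, {snd p})" "box ({fst p}, {snd p}) = {p}"
  using assms by (auto simp: code_def fincof_def small_def box_def)

lemma box_orth_iff_subset_perp:
  assumes "code m n x" "code m n y"
  shows "box_orth x y \<longleftrightarrow> box y \<subseteq> perp (box x)" "box_orth x y \<longleftrightarrow> box x \<subseteq> perp (box y)"
  using code_box_subset[OF assms(1)] code_box_subset[OF assms(2)] orth_sym
  unfolding box_orth_def perp_def by blast+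

text \<open>Single cells are codes themselves, so testing against all codes tests every
  cell.\<close>

lemma perp_eq_iff_box_orth:
  assumes "S \<subseteq> m \<times> n" "code m n z"
  shows "S = perp (box z) \<longleftrightarrow> (\<forall>u. code m n u \<longrightarrow> (box_orth z u \<longleftrightarrow> box u \<subseteq> S))"
proof
  assume "S = perp (box z)"
  then show "\<forall>u. code m n u \<longrightarrow> (box_orth z u \<longleftrightarrow> box u \<subseteq> S)"
    using box_orth_iff_subset_perp(1)[OF assms(2)] by simp
next
  assume *: "\<forall>u. code m n u \<longrightarrow> (box_orth z u \<longleftrightarrow> box u \<subseteq> S)"
  have "p \<in> S \<longleftrightarrow> p \<in> perp (box z)" if "p \<in> m \<times> n" for p
    using *[rule_format, OF code_point(1)[OF that]] code_point(2)[OF that]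
      box_orth_iff_subset_perp(1)[OF assms(2) code_point(1)[OF that]] by simp
  then show "S = perp (box z)" using assms(1) perp_subset[of "box z"] by blast
qed

lemma decode_subset_iff:
  assumes x: "code m n x" and y: "code m n y"
  shows "decode x \<subseteq> decode y \<longleftrightarrow> code_le m n x y"
proof
  assume le: "decode x \<subseteq> decode y"
  have "perp (decode y) \<subseteq> perp (decode x)" using le by (rule perp_antimono)
  then have "perp (box y) \<subseteq> perp (box x)"
    using code_adm[OF x] code_adm[OF y] by (simp add: decode_def)
  then show "code_le m n x y"
    unfolding code_le_def using box_orth_iff_subset_perp(1)[OF x] box_orth_iff_subset_perp(1)[OF y]
    by auto
next
  assume le: "code_le m n x y"
  have "p \<in> perp (box x)" if p: "p \<in> perp (box y)" for p
  proof -
    have pP: "p \<in> m \<times> n" using p perp_subset by blast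
    show ?thesis
      using le code_point[OF pP] p box_orth_iff_subset_perp(1)[OF x code_point(1)[OF pP]]
        box_orth_iff_subset_perp(1)[OF y code_point(1)[OF pP]]
      unfolding code_le_def by simp
  qed
  then show "decode x \<subseteq> decode y" unfolding decode_def by (intro perp_antimono subsetI)
qed

lemma decode_eq_iff:
  "code m n x \<Longrightarrow> code m n y \<Longrightarrow> decode x = decode y \<longleftrightarrow> code_le m n x y \<and> code_le m n y x"
  using decode_subset_iff[of x y] decode_subset_iff[of y x] by auto

lemma decode_subset_perp_iff:
  assumes x: "code m n x" and y: "code m n y"
  shows "decode x \<subseteq> perp (decode y) \<longleftrightarrow> box_orth x y"
proof
  assume "decode x \<subseteq> perp (decode y)"
  then have "decode x \<subseteq> perp (box y)" using code_adm[OF y] by (simp add: decode_def)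
  then have "box x \<subseteq> perp (box y)"
    using subset_perp_perp[OF code_box_subset[OF x]] by (simp add: decode_def)
  then show "box_orth x y" using box_orth_iff_subset_perp(2)[OF x y] by simp
next
  assume "box_orth x y"
  then have "box y \<subseteq> perp (box x)" using box_orth_iff_subset_perp(1)[OF x y] by simp
  then have "perp (perp (box x)) \<subseteq> perp (box y)" by (rule perp_antimono)
  then show "decode x \<subseteq> perp (decode y)" using code_adm[OF y] by (simp add: decode_def)
qed

text \<open>The equation is compared after taking orthocomplements, where the join turns into the
  intersection \<open>?S\<close>. As \<open>?S\<close> is closed, nothing is lost.\<close>

lemma djoin_decode:
  assumes x: "code m n x" and y: "code m n y" and z: "code m n z"
  shows "djoin alg (decode x) (decode y) = Some (decode z) \<longleftrightarrow> code_join m n x y z"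
proof -
  have p: "perp (decode x) = perp (box x)" "perp (decode y) = perp (box y)"
      "perp (decode z) = perp (box z)"
    using code_adm[OF x] code_adm[OF y] code_adm[OF z] by (simp_all add: decode_def)
  let ?S = "perp (box x) \<inter> perp (box y)"
  have S: "perp (perp ?S) = ?S"
    using perp_perp_perp[of "box x \<union> box y"] code_box_subset[OF x] code_box_subset[OF y]
    by (simp add: perp_Un)
  have "perp (perp (decode x) \<inter> perp (decode y)) = decode z \<longleftrightarrow> ?S = perp (box z)"
  proof
    assume "perp (perp (decode x) \<inter> perp (decode y)) = decode z"
    then have "perp (perp ?S) = perp (decode z)" by (simp add: p)
    then show "?S = perp (box z)" by (simp add: S p)
  next
    assume "?S = perp (box z)"
    then show "perp (perp (decode x) \<inter> perp (decode y)) = decode z"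
      by (simp add: p decode_def[of z])
  qed
  also have "\<dots> \<longleftrightarrow> (\<forall>u. code m n u \<longrightarrow> (box_orth z u \<longleftrightarrow> box u \<subseteq> ?S))"
    by (rule perp_eq_iff_box_orth[OF _ z]) (use perp_subset in blast)
  also have "\<dots> \<longleftrightarrow> (\<forall>u. code m n u \<longrightarrow> (box_orth z u \<longleftrightarrow> box_orth x u \<and> box_orth y u))"
    using box_orth_iff_subset_perp(1)[OF x] box_orth_iff_subset_perp(1)[OF y] by simp
  finally show ?thesis
    using decode_subset_perp_iff[OF x y] by (simp add: code_join_def)
qed

text \<open>A cell belongs to a closed set exactly when its atom lies below that set
  (\<open>mem_decode\<close>). Hence the codes below the difference determine it.\<close>

lemma dminus_decode:
  assumes x: "code m n x" and y: "code m n y" and z: "code m n z"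
  shows "dminus alg (decode x) (decode y) = Some (decode z) \<longleftrightarrow> code_minus m n x y z"
proof -
  have le_iff: "decode u \<subseteq> decode x \<inter> perp (decode y) \<longleftrightarrow> code_le m n u x \<and> box_orth y u"
    if "code m n u" for u
    using decode_subset_iff[OF that x] decode_subset_perp_iff[OF that y]
      box_orth_iff_subset_perp(1)[OF y that] box_orth_iff_subset_perp(2)[OF that y] by simp
  have mem_decode: "decode u \<subseteq> perp T \<longleftrightarrow> p \<in> perp T"
    if "p \<in> m \<times> n" "u = ({fst p}, {snd p})" "T \<subseteq> m \<times> n" for u p T
  proof
    assume "decode u \<subseteq> perp T"
    then show "p \<in> perp T"
      using subset_perp_perp[of "{p}"] code_point(2)[OF that(1)] that(1)
      by (auto simp: decode_def that(2))
  next
    assume "p \<in> perp T"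
    then have "T \<subseteq> perp {p}" using subset_perp_commute[of "{p}" T] that(1,3) by simp
    then have "perp (perp {p}) \<subseteq> perp T" by (rule perp_antimono)
    then show "decode u \<subseteq> perp T"
      using code_point(2)[OF that(1)] by (simp add: decode_def that(2))
  qed
  have S: "decode x \<inter> perp (decode y) = perp (perp (box x) \<union> box y)"
    using code_adm[OF y] by (simp add: decode_def perp_Un)
  have "decode x \<inter> perp (decode y) = decode z \<longleftrightarrow>
      (\<forall>u. code m n u \<longrightarrow> (code_le m n u z \<longleftrightarrow> code_le m n u x \<and> box_orth y u))"
  proof
    assume "decode x \<inter> perp (decode y) = decode z"
    then show "\<forall>u. code m n u \<longrightarrow> (code_le m n u z \<longleftrightarrow> code_le m n u x \<and> box_orth y u)"
      using le_iff decode_subset_iff[OF _ z] by simp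
  next
    assume *: "\<forall>u. code m n u \<longrightarrow> (code_le m n u z \<longleftrightarrow> code_le m n u x \<and> box_orth y u)"
    have "p \<in> decode x \<inter> perp (decode y) \<longleftrightarrow> p \<in> decode z" if p: "p \<in> m \<times> n" for p
    proof -
      let ?u = "({fst p}, {snd p})"
      have u: "code m n ?u" by (rule code_point(1)[OF p])
      have "decode ?u \<subseteq> decode z \<longleftrightarrow> decode ?u \<subseteq> decode x \<inter> perp (decode y)"
        using *[rule_format, OF u] le_iff[OF u] decode_subset_iff[OF u z] by simp
      moreover have "decode ?u \<subseteq> decode z \<longleftrightarrow> p \<in> decode z"
        unfolding decode_def[of z] by (rule mem_decode[OF p refl perp_subset])
      moreover have "decode ?u \<subseteq> decode x \<inter> perp (decode y) \<longleftrightarrow> p \<in> decode x \<inter> perp (decode y)"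
        unfolding S
        by (rule mem_decode[OF p refl]) (use perp_subset code_box_subset[OF y] in blast)
      ultimately show ?thesis by simp
    qed
    moreover have "decode z \<subseteq> m \<times> n" "decode x \<subseteq> m \<times> n"
      unfolding decode_def by (rule perp_subset)+
    ultimately show "decode x \<inter> perp (decode y) = decode z" by blast
  qed
  then show ?thesis
    using decode_subset_iff[OF y x] by (simp add: code_minus_def)
qed

end

section \<open>Transfer of first-order sentences between grids\<close>

abbreviation rook_algebra :: "'a set \<Rightarrow> 'b set \<Rightarrow> ('a \<times> 'b) set palg" where
  "rook_algebra m n \<equiv> orth_space.alg (m \<times> n) rook (grid_lines m n)"

text \<open>Atomic formulas count 2 because they hide quantifiers over rectangles; two is the cost
  of \<open>code_minus\<close>, the most expensive relation.\<close>

fun depth :: "fm \<Rightarrow> nat" where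
  "depth (Eq r s) = 2"
| "depth (RelJ r s t) = 2"
| "depth (RelK r s t) = 2"
| "depth (Neg \<phi>) = depth \<phi>"
| "depth (Conj \<phi> \<psi>) = max (depth \<phi>) (depth \<psi>)"
| "depth (Exi n \<phi>) = Suc (depth \<phi>)"

text \<open>Position 0 is reserved for an empty rectangle that names the constant, so variables are
  shifted by one.\<close>

fun tm_index :: "tm \<Rightarrow> nat" where
  "tm_index (Var n) = Suc n"
| "tm_index Zero = 0"

lemma (in grid) val_decode:
  "fst (e 0) = {} \<Longrightarrow> val alg (\<lambda>k. decode (e (Suc k))) t = decode (e (tm_index t))"
  by (cases t) (simp_all add: decode_def box_def)

text \<open>The usual back-and-forth induction. A quantifier over variable \<open>k\<close> moves at
  position \<open>Suc k\<close>, so the empty rectangle at position 0 survives all rounds.\<close>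

lemma sat_code_sim:
  fixes m :: "'a set" and n :: "'b set" and m' :: "'c set" and n' :: "'d set"
  assumes "grid m n" "grid m' n'"
    and "code_sim r m n m' n' e e'" "depth \<phi> \<le> r" "fst (e 0) = {}" "fst (e' 0) = {}"
  shows "sat (rook_algebra m n) (\<lambda>k. grid.decode m n (e (Suc k))) \<phi> \<longleftrightarrow>
    sat (rook_algebra m' n') (\<lambda>k. grid.decode m' n' (e' (Suc k))) \<phi>"
  using assms(3-)
proof (induction \<phi> arbitrary: r e e')
  interpret G: grid m n by (rule assms(1))
  interpret H: grid m' n' by (rule assms(2))
  {
    case (Eq s t)
    then obtain r' where r: "r = Suc r'" by (cases r) auto
    have c: "code m n (e i)" "code m' n' (e' i)" for i using Eq.prems(1) by (simp_all add: code_sim_def)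
    show ?case
      using code_le_sim[OF Eq.prems(1)[unfolded r]]
      by (simp add: G.val_decode[of e, OF Eq.prems(3)] H.val_decode[of e', OF Eq.prems(4)]
          G.decode_eq_iff H.decode_eq_iff c)
  next
    case (RelJ s t u)
    then obtain r' where r: "r = Suc r'" by (cases r) auto
    have c: "code m n (e i)" "code m' n' (e' i)" for i using RelJ.prems(1) by (simp_all add: code_sim_def)
    show ?case
      using code_join_sim[OF RelJ.prems(1)[unfolded r]]
      by (simp add: G.val_decode[of e, OF RelJ.prems(3)] H.val_decode[of e', OF RelJ.prems(4)]
          G.djoin_decode H.djoin_decode c del: G.alg_simps H.alg_simps)
  next
    case (RelK s t u)
    then obtain r' where r: "r = Suc (Suc r')" by (cases r rule: nat.exhaust; cases "r - 1") auto
    have c: "code m n (e i)" "code m' n' (e' i)" for i using RelK.prems(1) by (simp_all add: code_sim_def)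
    show ?case
      using code_minus_sim[OF RelK.prems(1)[unfolded r]]
      by (simp add: G.val_decode[of e, OF RelK.prems(3)] H.val_decode[of e', OF RelK.prems(4)]
          G.dminus_decode H.dminus_decode c del: G.alg_simps H.alg_simps)
  next
    case (Neg \<phi>)
    then show ?case by simp
  next
    case (Conj \<phi> \<psi>)
    from Conj.IH(1)[OF Conj.prems(1) _ Conj.prems(3,4)] Conj.IH(2)[OF Conj.prems(1) _ Conj.prems(3,4)]
    show ?case using Conj.prems(2) by simp
  next
    case (Exi k \<phi>)
    then obtain r' where r: "r = Suc r'" "depth \<phi> \<le> r'" by (cases r) auto
    have upd: "(\<lambda>i. d (e (Suc i)))(k := d x) = (\<lambda>i. d ((e(Suc k := x)) (Suc i)))"
      for d :: "'s \<Rightarrow> 't" and e x by auto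
    have IH: "sat G.alg ((\<lambda>i. G.decode (e (Suc i)))(k := G.decode x)) \<phi> \<longleftrightarrow>
        sat H.alg ((\<lambda>i. H.decode (e' (Suc i)))(k := H.decode x')) \<phi>"
      if "code_sim r' m n m' n' (e(Suc k := x)) (e'(Suc k := x'))" for x x'
      unfolding upd
      by (rule Exi.IH[OF that r(2)]) (use Exi.prems(3,4) in simp_all)
    have "\<exists>x'. code m' n' x' \<and> code_sim r' m n m' n' (e(Suc k := x)) (e'(Suc k := x'))"
      if "code m n x" for x
      using code_sim_extend[OF Exi.prems(1)[unfolded r] that] by metis
    moreover have "\<exists>x. code m n x \<and> code_sim r' m n m' n' (e(Suc k := x)) (e'(Suc k := x'))"
      if "code m' n' x'" for x'
      using code_sim_extend[OF code_sim_sym[OF Exi.prems(1)[unfolded r]] that] code_sim_sym by metis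
    ultimately show ?case
      unfolding sat.simps G.carr_decode H.carr_decode using IH
      by (simp only: bex_simps mem_Collect_eq) metis
  }
qed

lemma rook_algebra_equivalent:
  assumes "grid m n" "grid m' n'" and "sentence \<sigma> \<phi>"
    and cap: "capped (2 ^ Suc (depth \<phi>)) m = capped (2 ^ Suc (depth \<phi>)) m'"
      "capped (2 ^ Suc (depth \<phi>)) n = capped (2 ^ Suc (depth \<phi>)) n'"
  shows "models (rook_algebra m n) \<phi> \<longleftrightarrow> models (rook_algebra m' n') \<phi>"
proof -
  have "code_sim (depth \<phi>) m n m' n' (\<lambda>_. ({}, {})) (\<lambda>_. ({}, {}))"
    using set_sim_initial[OF cap(1)] set_sim_initial[OF cap(2)]
    by (simp add: code_sim_def code_def fincof_def small_def)
  from sat_code_sim[OF assms(1,2) this, of \<phi>] show ?thesis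
    using models_iff[OF assms(3), of "rook_algebra m n" "\<lambda>_. grid.decode m n ({}, {})"]
      models_iff[OF assms(3), of "rook_algebra m' n'" "\<lambda>_. grid.decode m' n' ({}, {})"] by simp
qed

section \<open>Isomorphic copies\<close>

text \<open>Grid algebras live on sets of cells; this moves them into the universe type over which
  the classes of the theorem range.\<close>

definition palg_image :: "('a \<Rightarrow> 'b) \<Rightarrow> 'a palg \<Rightarrow> 'b palg" where
  "palg_image g A = \<lparr>carr = g ` carr A,
     djoin = (\<lambda>a b. map_option g (djoin A (inv_into (carr A) g a) (inv_into (carr A) g b))),
     dminus = (\<lambda>a b. map_option g (dminus A (inv_into (carr A) g a) (inv_into (carr A) g b))),
     zero = g (zero A)\<rparr>"

lemma palg_iso_image: "inj_on g (carr A) \<Longrightarrow> palg_iso \<sigma> g A (palg_image g A)"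
  by (simp add: palg_iso_def palg_image_def bij_betw_def)

lemma partial_algebra_image:
  assumes A: "partial_algebra \<sigma> A"
  shows "partial_algebra \<sigma> (palg_image g A)"
  unfolding partial_algebra_def
proof (intro conjI impI ballI allI)
  let ?B = "palg_image g A"
  fix a b c assume \<sigma>: "DUnion \<in> \<sigma>" and ab: "a \<in> carr ?B" "b \<in> carr ?B"
    and c: "djoin ?B a b = Some c"
  have inv: "inv_into (carr A) g a \<in> carr A" "inv_into (carr A) g b \<in> carr A"
    using ab by (simp_all add: palg_image_def inv_into_into)
  obtain d where d: "djoin A (inv_into (carr A) g a) (inv_into (carr A) g b) = Some d" "c = g d"
    using c by (auto simp: palg_image_def)
  have "d \<in> carr A" using A \<sigma> inv d(1) unfolding partial_algebra_def by blast
  then show "c \<in> carr ?B" by (simp add: palg_image_def d(2))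
next
  let ?B = "palg_image g A"
  fix a b c assume \<sigma>: "DDiff \<in> \<sigma>" and ab: "a \<in> carr ?B" "b \<in> carr ?B"
    and c: "dminus ?B a b = Some c"
  have inv: "inv_into (carr A) g a \<in> carr A" "inv_into (carr A) g b \<in> carr A"
    using ab by (simp_all add: palg_image_def inv_into_into)
  obtain d where d: "dminus A (inv_into (carr A) g a) (inv_into (carr A) g b) = Some d" "c = g d"
    using c by (auto simp: palg_image_def)
  have "d \<in> carr A" using A \<sigma> inv d(1) unfolding partial_algebra_def by blast
  then show "c \<in> carr ?B" by (simp add: palg_image_def d(2))
next
  assume "Empt \<in> \<sigma>"
  then show "zero (palg_image g A) \<in> carr (palg_image g A)"
    using A by (simp add: partial_algebra_def palg_image_def)
qed

lemma palg_iso_comp: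
  assumes g: "palg_iso \<sigma> g A B" and h: "palg_iso \<sigma> h B C"
  shows "palg_iso \<sigma> (h \<circ> g) A C"
proof -
  have bij: "bij_betw g (carr A) (carr B)" "bij_betw h (carr B) (carr C)"
    using g h by (simp_all add: palg_iso_def)
  have gB: "g a \<in> carr B" if "a \<in> carr A" for a
    using bij_betwE[OF bij(1)] that by blast
  have comp: "map_option (h \<circ> g) v = map_option h (map_option g v)" for v
    by (simp add: option.map_comp)
  show ?thesis
    unfolding palg_iso_def comp
  proof (intro conjI impI ballI)
    show "bij_betw (h \<circ> g) (carr A) (carr C)" by (rule bij_betw_trans[OF bij])
    show "map_option h (map_option g (djoin A a b)) = djoin C ((h \<circ> g) a) ((h \<circ> g) b)"
      if "DUnion \<in> \<sigma>" "a \<in> carr A" "b \<in> carr A" for a b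
      using g h that gB[OF that(2)] gB[OF that(3)] by (simp add: palg_iso_def)
    show "map_option h (map_option g (dminus A a b)) = dminus C ((h \<circ> g) a) ((h \<circ> g) b)"
      if "DDiff \<in> \<sigma>" "a \<in> carr A" "b \<in> carr A" for a b
      using g h that gB[OF that(2)] gB[OF that(3)] by (simp add: palg_iso_def)
    show "(h \<circ> g) (zero A) = zero C" if "Empt \<in> \<sigma>"
      using g h that by (simp add: palg_iso_def)
  qed
qed

text \<open>Closure of \<open>A\<close> keeps the values of its operations in the carrier, where
  \<open>g\<close> can be undone.\<close>

lemma palg_iso_inv:
  assumes iso: "palg_iso \<sigma> g A B" and A: "partial_algebra \<sigma> A"
  shows "palg_iso \<sigma> (inv_into (carr A) g) B A"
proof -
  let ?h = "inv_into (carr A) g"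
  have bij: "bij_betw g (carr A) (carr B)" using iso by (simp add: palg_iso_def)
  have h: "?h b \<in> carr A" "g (?h b) = b" if "b \<in> carr B" for b
    by (rule bij_betw_apply[OF bij_betw_inv_into[OF bij] that])
      (rule bij_betw_inv_into_right[OF bij that])
  have hg: "map_option ?h (map_option g v) = v" if "\<And>c. v = Some c \<Longrightarrow> c \<in> carr A" for v
    using bij_betw_inv_into_left[OF bij that] by (cases v) simp_all
  have J: "map_option ?h (djoin B a b) = djoin A (?h a) (?h b)"
    if \<sigma>: "DUnion \<in> \<sigma>" and a: "a \<in> carr B" and b: "b \<in> carr B" for a b
  proof -
    have "map_option g (djoin A (?h a) (?h b)) = djoin B (g (?h a)) (g (?h b))"
      using iso \<sigma> h(1)[OF a] h(1)[OF b] unfolding palg_iso_def by blast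
    then have eq: "djoin B a b = map_option g (djoin A (?h a) (?h b))"
      unfolding h(2)[OF a] h(2)[OF b] by (rule sym)
    have "c \<in> carr A" if "djoin A (?h a) (?h b) = Some c" for c
      using A \<sigma> h(1)[OF a] h(1)[OF b] that unfolding partial_algebra_def by blast
    then show ?thesis unfolding eq by (rule hg)
  qed
  have K: "map_option ?h (dminus B a b) = dminus A (?h a) (?h b)"
    if \<sigma>: "DDiff \<in> \<sigma>" and a: "a \<in> carr B" and b: "b \<in> carr B" for a b
  proof -
    have "map_option g (dminus A (?h a) (?h b)) = dminus B (g (?h a)) (g (?h b))"
      using iso \<sigma> h(1)[OF a] h(1)[OF b] unfolding palg_iso_def by blast
    then have eq: "dminus B a b = map_option g (dminus A (?h a) (?h b))"
      unfolding h(2)[OF a] h(2)[OF b] by (rule sym)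
    have "c \<in> carr A" if "dminus A (?h a) (?h b) = Some c" for c
      using A \<sigma> h(1)[OF a] h(1)[OF b] that unfolding partial_algebra_def by blast
    then show ?thesis unfolding eq by (rule hg)
  qed
  have Z: "?h (zero B) = zero A" if "Empt \<in> \<sigma>"
  proof -
    have "g (zero A) = zero B" using iso that unfolding palg_iso_def by blast
    moreover have "zero A \<in> carr A" using A that unfolding partial_algebra_def by blast
    ultimately show ?thesis using bij_betw_inv_into_left[OF bij, of "zero A"] by simp
  qed
  show ?thesis
    unfolding palg_iso_def
    by (intro conjI impI ballI bij_betw_inv_into[OF bij] J K Z)
qed

lemma representation_iso:
  "palg_iso \<sigma> g A B \<Longrightarrow> representation \<sigma> B X \<theta> \<Longrightarrow> representation \<sigma> A X (\<theta> \<circ> g)"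
  by (auto simp: representation_def dest: palg_iso_comp)

lemma lesssim_iso:
  assumes iso: "palg_iso \<sigma> g A B" "DDiff \<in> \<sigma>" and ab: "a \<in> carr A" "b \<in> carr A"
  shows "lesssim B (g a) (g b) \<longleftrightarrow> lesssim A a b"
proof -
  have "map_option g (dminus A b a) = dminus B (g b) (g a)"
    using iso ab by (simp add: palg_iso_def)
  then have "dminus B (g b) (g a) \<noteq> None \<longleftrightarrow> dminus A b a \<noteq> None"
    by (metis option.map_disc_iff)
  moreover have "g a = g b \<longleftrightarrow> a = b"
    using iso(1) ab by (auto simp: palg_iso_def bij_betw_def inj_on_def)
  ultimately show ?thesis by (simp add: lesssim_def)
qed

lemma complete_representation_iso:
  assumes iso: "palg_iso \<sigma> g A B" "DDiff \<in> \<sigma>" and rep: "complete_representation \<sigma> B X \<theta>"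
  shows "complete_representation \<sigma> A X (\<theta> \<circ> g)"
  unfolding complete_representation_def
proof (intro conjI allI impI)
  show "representation \<sigma> A X (\<theta> \<circ> g)"
    by (rule representation_iso[OF iso(1)]) (use rep in \<open>simp add: complete_representation_def\<close>)
  fix S a assume S: "S \<subseteq> carr A" and comb: "pairwise_combinable A S" and sup: "is_supremum A S a"
  have B: "carr B = g ` carr A" using iso(1) by (simp add: palg_iso_def bij_betw_def)
  have "pairwise_combinable B (g ` S)"
    unfolding pairwise_combinable_def
  proof (intro ballI impI)
    fix s' t' assume "s' \<in> g ` S" "t' \<in> g ` S" "s' \<noteq> t'"
    then obtain s t where st: "s \<in> S" "t \<in> S" "s' = g s" "t' = g t" "s \<noteq> t" by blast
    then obtain u where u: "u \<in> carr A" "dminus A u s = Some t"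
      using comb unfolding pairwise_combinable_def by blast
    have "map_option g (dminus A u s) = dminus B (g u) (g s)"
      using iso u(1) st(1) S unfolding palg_iso_def by blast
    then have "dminus B (g u) s' = Some t'" using u(2) st by simp
    then show "\<exists>u\<in>carr B. dminus B u s' = Some t'" using u(1) B by blast
  qed
  moreover have "is_supremum B (g ` S) (g a)"
  proof -
    have a: "a \<in> carr A" using sup by (simp add: is_supremum_def)
    have 1: "lesssim B (g s) (g a)" if "s \<in> S" for s
    proof -
      have "s \<in> carr A" using that S by blast
      then show ?thesis using lesssim_iso[OF iso _ a] sup that by (simp add: is_supremum_def)
    qed
    have 2: "lesssim B (g a) (g b)" if b: "b \<in> carr A" and ub: "\<forall>s\<in>S. lesssim B (g s) (g b)" for b
    proof -
      have "lesssim A s b" if "s \<in> S" for s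
      proof -
        have "s \<in> carr A" using that S by blast
        from lesssim_iso[OF iso this b] show ?thesis using ub that by blast
      qed
      then have "lesssim A a b" using sup b by (simp add: is_supremum_def)
      then show ?thesis using lesssim_iso[OF iso a b] by simp
    qed
    show ?thesis using a 1 2 by (simp add: is_supremum_def B)
  qed
  moreover have "g ` S \<subseteq> carr B" using S B by blast
  ultimately have "\<theta> (g a) = (\<Union>s\<in>g ` S. \<theta> s)"
    using rep unfolding complete_representation_def by blast
  then show "(\<theta> \<circ> g) a = (\<Union>s\<in>S. (\<theta> \<circ> g) s)" by simp
qed

text \<open>Assignments are confined to the carrier, since an isomorphism says nothing about
  operations or injectivity outside it.\<close>

lemma sat_iso:
  assumes iso: "palg_iso \<sigma> g A B" and A: "partial_algebra \<sigma> A"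
    and "symbs \<phi> \<subseteq> \<sigma>" "\<And>n. e n \<in> carr A"
  shows "sat B (g \<circ> e) \<phi> \<longleftrightarrow> sat A e \<phi>"
  using assms(3-)
proof (induction \<phi> arbitrary: e)
  have inj: "g a = g b \<longleftrightarrow> a = b" if "a \<in> carr A" "b \<in> carr A" for a b
    using iso that by (auto simp: palg_iso_def bij_betw_def inj_on_def)
  have zero: "zero A \<in> carr A" "g (zero A) = zero B" if "Empt \<in> \<sigma>"
    using iso A that unfolding palg_iso_def partial_algebra_def by blast+
  have v: "val A e t \<in> carr A" "val B (g \<circ> e) t = g (val A e t)"
    if "tm_symbs t \<subseteq> \<sigma>" "\<And>n. e n \<in> carr A" for e t
    using that zero by (cases t; simp)+
  have some: "map_option g w = Some (g c) \<longleftrightarrow> w = Some c"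
    if "c \<in> carr A" "\<And>d. w = Some d \<Longrightarrow> d \<in> carr A" for w c
    using that inj by (cases w) auto
  {
    case (Eq r s)
    then have "tm_symbs r \<subseteq> \<sigma>" "tm_symbs s \<subseteq> \<sigma>" by simp_all
    then show ?case using v[of r e] v[of s e] Eq.prems(2) inj by (simp add: comp_def)
  next
    case (RelJ r s t)
    then have *: "tm_symbs r \<subseteq> \<sigma>" "tm_symbs s \<subseteq> \<sigma>" "tm_symbs t \<subseteq> \<sigma>" and \<sigma>: "DUnion \<in> \<sigma>"
      by simp_all
    note c = v(1)[of r e, OF *(1) RelJ.prems(2)] v(1)[of s e, OF *(2) RelJ.prems(2)] v(1)[of t e, OF *(3) RelJ.prems(2)]
    note gc = v(2)[of r e, OF *(1) RelJ.prems(2)] v(2)[of s e, OF *(2) RelJ.prems(2)] v(2)[of t e, OF *(3) RelJ.prems(2)]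
    have "djoin B (g (val A e r)) (g (val A e s)) = map_option g (djoin A (val A e r) (val A e s))"
      using iso \<sigma> c by (simp add: palg_iso_def)
    moreover have "d \<in> carr A" if "djoin A (val A e r) (val A e s) = Some d" for d
      using A \<sigma> c that unfolding partial_algebra_def by blast
    ultimately show ?case using gc some[OF c(3)] by (simp add: comp_def)
  next
    case (RelK r s t)
    then have *: "tm_symbs r \<subseteq> \<sigma>" "tm_symbs s \<subseteq> \<sigma>" "tm_symbs t \<subseteq> \<sigma>" and \<sigma>: "DDiff \<in> \<sigma>"
      by simp_all
    note c = v(1)[of r e, OF *(1) RelK.prems(2)] v(1)[of s e, OF *(2) RelK.prems(2)] v(1)[of t e, OF *(3) RelK.prems(2)]
    note gc = v(2)[of r e, OF *(1) RelK.prems(2)] v(2)[of s e, OF *(2) RelK.prems(2)] v(2)[of t e, OF *(3) RelK.prems(2)]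
    have "dminus B (g (val A e r)) (g (val A e s)) = map_option g (dminus A (val A e r) (val A e s))"
      using iso \<sigma> c by (simp add: palg_iso_def)
    moreover have "d \<in> carr A" if "dminus A (val A e r) (val A e s) = Some d" for d
      using A \<sigma> c that unfolding partial_algebra_def by blast
    ultimately show ?case using gc some[OF c(3)] by (simp add: comp_def)
  next
    case (Neg \<phi>)
    then show ?case by simp
  next
    case (Conj \<phi> \<psi>)
    then show ?case by simp
  next
    case (Exi n \<phi>)
    have "sat B ((g \<circ> e)(n := g a)) \<phi> \<longleftrightarrow> sat A (e(n := a)) \<phi>" if "a \<in> carr A" for a
    proof -
      have "sat B (g \<circ> e(n := a)) \<phi> \<longleftrightarrow> sat A (e(n := a)) \<phi>"
        by (rule Exi.IH) (use Exi.prems that in auto)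
      then show ?thesis by (simp only: fun_upd_comp)
    qed
    moreover have "carr B = g ` carr A" using iso by (simp add: palg_iso_def bij_betw_def)
    ultimately show ?case by (simp add: comp_def)
  }
qed

lemma models_iso:
  assumes "palg_iso \<sigma> g A B" "partial_algebra \<sigma> A" "sentence \<sigma> \<phi>" "carr A \<noteq> {}"
  shows "models B \<phi> \<longleftrightarrow> models A \<phi>"
proof -
  obtain a where "a \<in> carr A" using assms(4) by blast
  then show ?thesis
    using sat_iso[OF assms(1,2), of \<phi> "\<lambda>_. a"] assms(3)
      models_iff[OF assms(3), of A "\<lambda>_. a"] models_iff[OF assms(3), of B "g \<circ> (\<lambda>_. a)"]
    by (simp add: sentence_def)
qed

section \<open>Fitting the algebras into an infinite type\<close>

lemma infinite_inj_pair:
  assumes "infinite (UNIV :: 'v set)" shows "\<exists>f :: 'v \<times> 'v \<Rightarrow> 'v. inj f"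
  using card_of_Times_same_infinite[OF assms] card_of_ordLeq[of "UNIV \<times> UNIV :: ('v \<times> 'v) set"]
    ordIso_imp_ordLeq by (metis UNIV_Times_UNIV)

lemma infinite_inj_nat:
  "infinite (UNIV :: 'v set) \<Longrightarrow> \<exists>f :: nat \<Rightarrow> 'v. inj f"
  using infinite_countable_subset by blast

lemma infinite_inj_list:
  assumes "infinite (UNIV :: 'v set)" shows "\<exists>f :: 'v list \<Rightarrow> 'v. inj f"
proof -
  obtain p :: "'v \<times> 'v \<Rightarrow> 'v" where p: "inj p" using infinite_inj_pair[OF assms] by blast
  obtain N :: "nat \<Rightarrow> 'v" where N: "inj N" using infinite_inj_nat[OF assms] by blast
  \<comment> \<open>The base value is arbitrary. Folding separates only lists of equal length, so
    the final code also stores the length.\<close>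
  define f where "f xs = foldr (\<lambda>x y. p (x, y)) xs undefined" for xs
  have f: "xs = ys" if "length xs = length ys" "f xs = f ys" for xs ys
    using that
  proof (induction xs ys rule: list_induct2)
    case (Cons x xs y ys)
    then show ?case using injD[OF p, of "(x, f xs)" "(y, f ys)"] by (simp add: f_def)
  qed simp
  have "inj (\<lambda>xs. p (N (length xs), f xs))"
    by (rule injI) (use f injD[OF p] injD[OF N] in blast)
  then show ?thesis by blast
qed

text \<open>A flag and a finite list of points name an element: the list enumerates \<open>x\<close>
  if \<open>x\<close> is finite, and otherwise \<open>L - x\<close>, whose single
  \<open>perp\<close> is the same element. The line itself need not be recorded.\<close>

lemma (in orth_space) carr_inj:
  assumes "infinite (UNIV :: 'v set)" and h: "inj (h :: 'p \<Rightarrow> 'v)"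
  shows "\<exists>g :: 'p set \<Rightarrow> 'v. inj_on g (carr alg)"
proof -
  obtain p :: "'v \<times> 'v \<Rightarrow> 'v" where p: "inj p" using infinite_inj_pair[OF assms(1)] by blast
  obtain N :: "nat \<Rightarrow> 'v" where N: "inj N" using infinite_inj_nat[OF assms(1)] by blast
  obtain f :: "'v list \<Rightarrow> 'v" where f: "inj f" using infinite_inj_list[OF assms(1)] by blast
  define H where "H = (\<lambda>(b, xs). if b then perp (perp (set xs)) else perp (set xs))"
  have "carr alg \<subseteq> range H"
  proof
    fix a assume "a \<in> carr alg"
    then obtain x where x: "adm x" "a = perp (perp x)" by (rule carrE)
    then obtain L where L: "L \<in> lines" "x \<subseteq> L" "finite x \<or> finite (L - x)"
      by (auto simp: adm_def)
    from L(3) show "a \<in> range H"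
    proof
      assume "finite x"
      then obtain xs where "set xs = x" using finite_list by blast
      then have "a = H (True, xs)" by (simp add: H_def x)
      then show ?thesis by blast
    next
      assume "finite (L - x)"
      then obtain xs where "set xs = L - x" using finite_list by blast
      then have "a = H (False, xs)" using perp_Diff[OF L(1,2)] by (simp add: H_def x)
      then show ?thesis by blast
    qed
  qed
  then have "inj_on (inv H) (carr alg)" by (rule inj_on_inv_into)
  moreover have "inj (\<lambda>(b, xs). p (N (of_bool b), f (map h xs)))"
  proof (rule injI, clarify)
    fix b xs b' xs' assume "p (N (of_bool b), f (map h xs)) = p (N (of_bool b'), f (map h xs'))"
    then have "of_bool b = (of_bool b' :: nat)" "map h xs = map h xs'"
      using injD[OF p] injD[OF N] injD[OF f] by blast+
    then show "b = b' \<and> xs = xs'" using h by (simp add: inj_map_eq_map of_bool_eq_iff)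
  qed
  ultimately have "inj_on ((\<lambda>(b, xs). p (N (of_bool b), f (map h xs))) \<circ> inv H) (carr alg)"
    by (meson comp_inj_on inj_on_subset subset_UNIV)
  then show ?thesis by blast
qed

lemma (in grid) carr_nonempty: "carr alg \<noteq> {}"
proof -
  obtain L where "L \<in> grid_lines m n" using grid_nonempty by blast
  then have "adm {}" by (auto simp: adm_def)
  from perp_mem_carr[OF this] show ?thesis by blast
qed

section \<open>Copies in the universe type and the two refutations\<close>

lemma rook_algebra_copy:
  assumes "grid (m :: 'a set) (n :: 'b set)" and inf: "infinite (UNIV :: 'v set)"
    and h: "inj (h :: 'a \<times> 'b \<Rightarrow> 'v)"
  obtains g :: "('a \<times> 'b) set \<Rightarrow> 'v" and B where "palg_iso \<sigma> g (rook_algebra m n) B"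
    "partial_algebra \<sigma> B" "partial_algebra \<sigma> (rook_algebra m n)"
    "\<And>\<phi>. sentence \<sigma> \<phi> \<Longrightarrow> models B \<phi> \<longleftrightarrow> models (rook_algebra m n) \<phi>"
proof -
  interpret grid m n by (rule assms(1))
  obtain g :: "('a \<times> 'b) set \<Rightarrow> 'v" where g: "inj_on g (carr alg)" using carr_inj[OF inf h] by blast
  have A: "partial_algebra \<sigma> alg" using grid_nonempty(2) by (rule partial_algebra_alg)
  have iso: "palg_iso \<sigma> g alg (palg_image g alg)" using g by (rule palg_iso_image)
  show thesis
    by (rule that[OF iso partial_algebra_image[OF A] A]) (rule models_iso[OF iso A _ carr_nonempty])
qed

lemma square_completely_representable:
  assumes "grid m m" "palg_iso \<sigma> g (rook_algebra m m) B" "DDiff \<in> \<sigma>" "partial_algebra \<sigma> B"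
  shows "completely_representable \<sigma> B"
proof -
  interpret square_grid m by (simp add: square_grid_def assms(1))
  have "partial_algebra \<sigma> alg" using grid_nonempty(2) by (rule partial_algebra_alg)
  from complete_representation_iso[OF palg_iso_inv[OF assms(2) this] assms(3)
      complete_representation_matchings]
  show ?thesis by (rule completely_representableI[OF assms(4)])
qed

lemma representable_of_complete: "completely_representable \<sigma> A \<Longrightarrow> representable \<sigma> A"
  unfolding completely_representable_def representable_def complete_representation_def by blast

theorem theorem5p13:
  fixes \<sigma> :: "symb set"
  assumes "DDiff \<in> \<sigma>"
    and "infinite (UNIV :: 'u set)"
    and "uncountable (UNIV :: 'v set)"
  shows "\<not> finitely_axiomatisable \<sigma> (representable \<sigma> :: 'u palg \<Rightarrow> bool) \<and>
    \<not> closed_under_elementary_equivalence \<sigma> (completely_representable \<sigma> :: 'v palg \<Rightarrow> bool)"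
proof
  show "\<not> finitely_axiomatisable \<sigma> (representable \<sigma> :: 'u palg \<Rightarrow> bool)"
  proof
    assume "finitely_axiomatisable \<sigma> (representable \<sigma> :: 'u palg \<Rightarrow> bool)"
    then obtain T where T: "finite T" "\<And>\<phi>. \<phi> \<in> T \<Longrightarrow> sentence \<sigma> \<phi>"
        "\<And>A :: 'u palg. partial_algebra \<sigma> A \<Longrightarrow> representable \<sigma> A \<longleftrightarrow> (\<forall>\<phi>\<in>T. models A \<phi>)"
      unfolding finitely_axiomatisable_def by blast
    \<comment> \<open>The 3 makes both sides large enough for a grid. The maximum exceeds or equals
      every threshold occurring for \<open>T\<close>, so \<open>k\<close> and \<open>Suc k\<close>
      have equal truncated sizes for all its sentences.\<close>
    define k :: nat where "k = Max (insert 3 ((\<lambda>\<phi>. 2 ^ Suc (depth \<phi>)) ` T))"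
    have k: "3 \<le> k" "\<And>\<phi>. \<phi> \<in> T \<Longrightarrow> 2 ^ Suc (depth \<phi>) \<le> k"
      using T(1) by (auto simp: k_def)
    let ?m = "{..<k}" and ?n = "{..<Suc k}"
    have grids: "grid ?m ?m" "grid ?m ?n"
      using k(1) by (auto intro!: grid.intro at_least3_card)
    obtain N :: "nat \<Rightarrow> 'u" where N: "inj N" using infinite_inj_nat[OF assms(2)] by blast
    have h: "inj (N \<circ> prod_encode)" using N inj_prod_encode[of UNIV] by (rule inj_compose)
    obtain gA and A :: "'u palg" where A: "palg_iso \<sigma> gA (rook_algebra ?m ?m) A"
        "partial_algebra \<sigma> A" "partial_algebra \<sigma> (rook_algebra ?m ?m)"
        "\<And>\<phi>. sentence \<sigma> \<phi> \<Longrightarrow> models A \<phi> \<longleftrightarrow> models (rook_algebra ?m ?m) \<phi>"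
      using rook_algebra_copy[OF grids(1) assms(2) h] by metis
    obtain gB and B :: "'u palg" where B: "palg_iso \<sigma> gB (rook_algebra ?m ?n) B"
        "partial_algebra \<sigma> B" "partial_algebra \<sigma> (rook_algebra ?m ?n)"
        "\<And>\<phi>. sentence \<sigma> \<phi> \<Longrightarrow> models B \<phi> \<longleftrightarrow> models (rook_algebra ?m ?n) \<phi>"
      using rook_algebra_copy[OF grids(2) assms(2) h] by metis
    have "representable \<sigma> A"
      by (rule representable_of_complete)
        (rule square_completely_representable[OF grids(1) A(1) assms(1) A(2)])
    then have "models A \<phi>" if "\<phi> \<in> T" for \<phi> using T(3)[OF A(2)] that by blast
    moreover have "models A \<phi> \<longleftrightarrow> models B \<phi>" if "\<phi> \<in> T" for \<phi>
      unfolding A(4)[OF T(2)[OF that]] B(4)[OF T(2)[OF that]]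
      by (rule rook_algebra_equivalent[OF grids T(2)[OF that] refl])
        (use k(2)[OF that] in \<open>simp add: capped_def\<close>)
    ultimately have "representable \<sigma> B" using T(3)[OF B(2)] by blast
    then obtain X :: "'u set set" and \<theta> where "representation \<sigma> B X \<theta>"
      unfolding representable_def by blast
    from grid.finite_representation_inj[OF grids(2) representation_iso[OF B(1) this] assms(1)]
    obtain f where "inj_on f ?n" "f ` ?n \<subseteq> ?m" by blast
    then have "card ?n \<le> card ?m" by (intro card_inj_on_le) auto
    then show False by simp
  qed
next
  show "\<not> closed_under_elementary_equivalence \<sigma> (completely_representable \<sigma> :: 'v palg \<Rightarrow> bool)"
  proof
    assume closed: "closed_under_elementary_equivalence \<sigma> (completely_representable \<sigma> :: 'v palg \<Rightarrow> bool)"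
    have inf: "infinite (UNIV :: 'v set)" using assms(3) countable_finite by blast
    \<comment> \<open>All infinite sets have the same truncated size at every threshold, so each
      sentence is preserved; countability of one side alone excludes an injection from the
      other.\<close>
    let ?m = "UNIV :: nat set" and ?n = "UNIV :: 'v set"
    have grids: "grid ?m ?m" "grid ?m ?n"
      using inf by (auto intro!: grid.intro at_least3_infinite)
    obtain N :: "nat \<Rightarrow> 'v" where N: "inj N" using infinite_inj_nat[OF inf] by blast
    obtain p :: "'v \<times> 'v \<Rightarrow> 'v" where p: "inj p" using infinite_inj_pair[OF inf] by blast
    have hA: "inj (N \<circ> prod_encode)" using N inj_prod_encode[of UNIV] by (rule inj_compose)
    have hB: "inj (p \<circ> map_prod N id)" using p prod.inj_map[OF N inj_on_id] by (rule inj_compose)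
    obtain gA and A :: "'v palg" where A: "palg_iso \<sigma> gA (rook_algebra ?m ?m) A"
        "partial_algebra \<sigma> A" "partial_algebra \<sigma> (rook_algebra ?m ?m)"
        "\<And>\<phi>. sentence \<sigma> \<phi> \<Longrightarrow> models A \<phi> \<longleftrightarrow> models (rook_algebra ?m ?m) \<phi>"
      using rook_algebra_copy[OF grids(1) inf hA] by metis
    obtain gB and B :: "'v palg" where B: "palg_iso \<sigma> gB (rook_algebra ?m ?n) B"
        "partial_algebra \<sigma> B" "partial_algebra \<sigma> (rook_algebra ?m ?n)"
        "\<And>\<phi>. sentence \<sigma> \<phi> \<Longrightarrow> models B \<phi> \<longleftrightarrow> models (rook_algebra ?m ?n) \<phi>"
      using rook_algebra_copy[OF grids(2) inf hB] by metis
    have "elementarily_equivalent \<sigma> A B"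
      unfolding elementarily_equivalent_def
    proof (intro allI impI)
      fix \<phi> assume \<phi>: "sentence \<sigma> \<phi>"
      show "models A \<phi> \<longleftrightarrow> models B \<phi>"
        unfolding A(4)[OF \<phi>] B(4)[OF \<phi>]
        by (rule rook_algebra_equivalent[OF grids \<phi> refl]) (use inf in \<open>simp add: capped_def\<close>)
    qed
    moreover have "completely_representable \<sigma> A"
      by (rule square_completely_representable[OF grids(1) A(1) assms(1) A(2)])
    ultimately have "completely_representable \<sigma> B"
      using closed A(2) B(2) unfolding closed_under_elementary_equivalence_def by blast
    then obtain X :: "'v set set" and \<theta> where "complete_representation \<sigma> B X \<theta>"
      unfolding completely_representable_def by blast
    from grid.complete_representation_inj[OF grids(2)
        complete_representation_iso[OF B(1) assms(1) this] assms(1)]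
    obtain f :: "'v \<Rightarrow> nat" where "inj f" by blast
    then show False using assms(3) by (auto simp: countable_def)
  qed
qed

end
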